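(* For $q,n\in\mathbb N$ let $f_q(n)$ be the number of ordered Sidon sets of length at most $n$ and size $q$. Then $f_q(n)$ is a two-level quasi-polynomial of degree function $q$ and infinite depth.
   Context: $\mathbb N=\{0,1,2,\dots\}$. A Sidon set of size $q$ is a set of $q$ distinct integers $s_1<\dots<s_q$ such that all the pairwise differences $s_j-s_i$ ($i<j$) are distinct. An ordered Sidon set of length at most $n$ and size $q$ is a tuple $(s_1,\dots,s_q)\in\{0,1,\dots,n\}^q$ (not necessarily in increasing order, and not required to contain $0$ or $n$) whose entries are distinct and form a Sidon set. A function $f:\mathbb N\to\mathbb Q$ is a quasi-polynomial of degree $d$ if $f(n)=\sum_{r=0}^d b_r(n)n^{d-r}$ with periodic $b_r:\mathbb N\to\mathbb Q$ and $b_0$ not identically zero. A numerical polynomial is $g\in\mathbb Q[x]$ with $g(q)\in\mathbb Z$ for all $q\in\mathbb Z$. Two-level quasi-polynomial: let $g$ be an eventually nonnegative numerical polynomial, $S=\{q\in\mathbb N: g(q)\ge 0\}$, $e:S\to\mathbb N\cup\{-1,\infty\}$, and $p:\mathbb N\to\mathbb Z_{>0}$ with $p(r)\mid p(r+1)$ for all $r$. A two-level quasi-polynomial of degree function $g$, depth function $e$ and period function $p$ is a sequence $\{f_q\}_{q\in S}$ of quasi-polynomials, $f_q$ of degree $g(q)$, such that, writing $f_q(n)=\sum_{r\ge0}c_r(q;n)n^{g(q)-r}$ with $c_r(q;n)$ periodic in $n$ and $c_r(q;n)=0$ for $r>g(q)$, there exist polynomials $\phi_r(q;i)$ in $q$ ($r\ge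 0$, $0\le i<p(r)$) with $c_r(q;n)=\phi_r(q;\,n\bmod p(r))$ for all $n\in\mathbb N$, $q\in S$ and $r\le e(q)$. Infinite depth means $e(q)=\infty$ for all $q\in S$. When no period function is specified, the assertion is that some period function exists. *)

theory Defs
  imports
    Complex_Main
    "HOL-Computational_Algebra.Polynomial"
    "HOL-Library.Extended"
begin

definition sidon_set :: "int set \<Rightarrow> bool" where
  "sidon_set A \<longleftrightarrow>
     finite A \<and> inj_on (\<lambda>(a, b). b - a) {(a, b). a \<in> A \<and> b \<in> A \<and> a < b}"

text \<open>Tuples are lists. The length bound \<open>n\<close> restricts the entries to \<open>{0..n}\<close>;
  neither \<open>0\<close> nor \<open>n\<close> has to occur.\<close>

definition ordered_sidon_sets :: "nat \<Rightarrow> nat \<Rightarrow> int list set" where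
  "ordered_sidon_sets q n =
     {s. length s = q \<and> set s \<subseteq> {0..int n} \<and> distinct s \<and> sidon_set (set s)}"

definition periodic :: "(nat \<Rightarrow> rat) \<Rightarrow> bool" where
  "periodic b \<longleftrightarrow> (\<exists>m>0. \<forall>n. b (n + m) = b n)"

definition quasi_polynomial :: "nat \<Rightarrow> (nat \<Rightarrow> rat) \<Rightarrow> bool" where
  "quasi_polynomial d f \<longleftrightarrow>
     (\<exists>b. (\<forall>r\<le>d. periodic (b r)) \<and> (\<exists>n. b 0 n \<noteq> 0) \<and>
          (\<forall>n. f n = (\<Sum>r\<le>d. b r n * of_nat n ^ (d - r))))"

definition numerical_polynomial :: "rat poly \<Rightarrow> bool" where
  "numerical_polynomial g \<longleftrightarrow> (\<forall>q::int. poly g (of_int q) \<in> \<int>)"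

definition nonneg_set :: "rat poly \<Rightarrow> nat set" where
  "nonneg_set g = {q. poly g (of_nat q) \<ge> 0}"

text \<open>The value of \<open>g\<close> as a natural number; faithful only for numerical \<open>g\<close> and
  \<open>q \<in> nonneg_set g\<close>.\<close>

definition deg_at :: "rat poly \<Rightarrow> nat \<Rightarrow> nat" where
  "deg_at g q = nat \<lfloor>poly g (of_nat q)\<rfloor>"

text \<open>\<open>two_level_quasi_polynomial g e p f\<close>: the sequence \<open>f q\<close>, \<open>q \<in> nonneg_set g\<close>, has
  degree function \<open>g\<close>, depth function \<open>e\<close> and period function \<open>p\<close>. Values of \<open>e\<close> and \<open>f\<close>
  outside \<open>nonneg_set g\<close> are irrelevant. The coefficient functions \<open>c q r\<close> are determined by
  \<open>f q\<close>, since a quasi-polynomial has only one expansion with periodic coefficients.\<close>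

definition two_level_quasi_polynomial ::
  "rat poly \<Rightarrow> (nat \<Rightarrow> int extended) \<Rightarrow> (nat \<Rightarrow> nat) \<Rightarrow> (nat \<Rightarrow> nat \<Rightarrow> rat) \<Rightarrow> bool" where
  "two_level_quasi_polynomial g e p f \<longleftrightarrow>
     numerical_polynomial g \<and>
     (\<forall>\<^sub>F q in sequentially. poly g (of_nat q) \<ge> 0) \<and>
     (\<forall>q\<in>nonneg_set g. e q = \<infinity> \<or> (\<exists>k\<ge>-1. e q = Fin k)) \<and>
     (\<forall>r. p r > 0 \<and> p r dvd p (Suc r)) \<and>
     (\<forall>q\<in>nonneg_set g. quasi_polynomial (deg_at g q) (f q)) \<and>
     (\<exists>(c :: nat \<Rightarrow> nat \<Rightarrow> nat \<Rightarrow> rat) (\<phi> :: nat \<Rightarrow> nat \<Rightarrow> rat poly).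
        \<forall>q\<in>nonneg_set g.
          (\<forall>r. periodic (c q r)) \<and>
          (\<forall>r>deg_at g q. \<forall>n. c q r n = 0) \<and>
          (\<forall>n. f q n = (\<Sum>r\<le>deg_at g q. c q r n * of_nat n ^ (deg_at g q - r))) \<and>
          (\<forall>r n. Fin (int r) \<le> e q \<longrightarrow> c q r n = poly (\<phi> r (n mod p r)) (of_nat q)))"

definition infinite_depth :: "rat poly \<Rightarrow> (nat \<Rightarrow> int extended) \<Rightarrow> bool" where
  "infinite_depth g e \<longleftrightarrow> (\<forall>q\<in>nonneg_set g. e q = \<infinity>)"

end

theory Submission
  imports Defs "HOL-Library.FuncSet"
begin

text \<open>
  Write \<open>f\<^sub>q(n)\<close> for the number of ordered Sidon sets of size \<open>q\<close> in \<open>{0..n}\<close>. A tuple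
  \<open>y\<close> indexed by \<open>J\<close> is an ordered Sidon set iff all sums of two entries are distinct
  (\<open>distinct_sums y J\<close>), so a failure is a relation \<open>y\<^sub>a + y\<^sub>b = y\<^sub>c + y\<^sub>d\<close> that
  involves at most four indices. Everything rests on this bound and on two properties of
  these relations: they are homogeneous and invariant under translation.

  \<^emph>\<open>Fixed size.\<close> Counting tuples in \<open>{0..n}\<close> that satisfy homogeneous linear conditions is
  a repeated summation of piecewise quasi-polynomials. The pieces are cones, and summing over
  one variable keeps them cones (\<open>conic_quasi_poly_sum_variable\<close>); on the ray \<open>n > 0\<close> a cone
  is all or nothing, so the count is there a single quasi-polynomial. For it to be one at
  \<open>n = 0\<close> as well, translation invariance is used: \<open>f\<^sub>q(n) - f\<^sub>q(n - 1)\<close> counts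
  the tuples with some entry \<open>0\<close>, again a homogeneous condition, and the sum over \<open>1..n\<close> of a
  quasi-polynomial is a quasi-polynomial whose value at \<open>0\<close> is the empty sum
  (\<open>card_ordered_sidon_sets_quasi_poly\<close>).

  \<^emph>\<open>Dependence on the size.\<close> Moebius inversion over the sets of indices gives
  \<open>f\<^sub>q(n) = (\<Sum>k\<le>q. (q choose k) * (n + 1) ^ (q - k) * w\<^sub>k(n))\<close>, where
  \<open>w\<^sub>k(n)\<close> is the alternating sum over \<open>J \<subseteq> {..<k}\<close> of the number of points of
  \<open>{0..n}\<^sup>k\<close> whose restriction to \<open>J\<close> is Sidon (\<open>sidon_defect\<close>). In \<open>w\<^sub>k\<close>, a point
  contributes \<open>0\<close> as soon as one index takes part in no relation, because adding or removing that
  index does not change whether \<open>J\<close> is Sidon. If every index takes part in some relation, then at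
  least \<open>k / 4\<close> of the entries are determined by the others, as each relation covers at most
  four indices. Hence \<open>w\<^sub>k(n)\<close> grows at most like \<open>n\<close> to the power \<open>3 * k div 4\<close>
  (\<open>sidon_defect_growth\<close>), and a quasi-polynomial with this growth has this degree.

  Consequently only the \<open>w\<^sub>k\<close> with \<open>k \<le> 4 * r\<close> contribute to the coefficient of
  \<open>n ^ (q - r)\<close> in \<open>f\<^sub>q\<close>, with factors \<open>(q choose k) * ((q - k) choose i)\<close>, where
  \<open>i \<le> r\<close>, that are polynomials in \<open>q\<close>; and a common period of these finitely many
  \<open>w\<^sub>k\<close> is a period for the coefficient, whatever \<open>q\<close> is.
\<close>

section \<open>Quasi-polynomials on the integers\<close>

text \<open>
  Being defined on all integers, and not only for \<open>n \<ge> 0\<close>, these functions can be composed with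
  linear forms and have antidifferences that are valid at every argument.
\<close>

definition int_quasi_poly :: "(int \<Rightarrow> rat) \<Rightarrow> bool" where
  "int_quasi_poly f \<longleftrightarrow>
     (\<exists>m>0. \<exists>P :: int \<Rightarrow> rat poly. \<forall>u. f u = poly (P (u mod m)) (of_int u))"

lemma int_quasi_polyI:
  assumes "m > 0" "\<And>u. f u = poly (P (u mod m)) (of_int u)"
  shows "int_quasi_poly f"
  using assms unfolding int_quasi_poly_def by blast

lemma int_quasi_poly_const: "int_quasi_poly (\<lambda>u. a)"
  by (rule int_quasi_polyI[of 1 _ "\<lambda>_. [:a:]"]) auto

lemma int_quasi_poly_of_int: "int_quasi_poly of_int"
  by (rule int_quasi_polyI[of 1 _ "\<lambda>_. [:0, 1:]"]) auto

lemma int_quasi_poly_binop: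
  fixes op :: "rat \<Rightarrow> rat \<Rightarrow> rat" and pop :: "rat poly \<Rightarrow> rat poly \<Rightarrow> rat poly"
  assumes "int_quasi_poly f" "int_quasi_poly g"
    and "\<And>p q x. poly (pop p q) x = op (poly p x) (poly q x)"
  shows "int_quasi_poly (\<lambda>u. op (f u) (g u))"
proof -
  obtain m P where m: "m > 0" "\<And>u. f u = poly (P (u mod m)) (of_int u)"
    using assms(1) unfolding int_quasi_poly_def by blast
  obtain k Q where k: "k > 0" "\<And>u. g u = poly (Q (u mod k)) (of_int u)"
    using assms(2) unfolding int_quasi_poly_def by blast
  show ?thesis
    by (rule int_quasi_polyI[of "m * k" _ "\<lambda>r. pop (P (r mod m)) (Q (r mod k))"])
       (use m k assms(3) in \<open>simp_all add: mod_mod_cancel\<close>)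
qed

lemma int_quasi_poly_add:
  "int_quasi_poly f \<Longrightarrow> int_quasi_poly g \<Longrightarrow> int_quasi_poly (\<lambda>u. f u + g u)"
  by (rule int_quasi_poly_binop[where pop = "(+)"]) auto

lemma int_quasi_poly_mult:
  "int_quasi_poly f \<Longrightarrow> int_quasi_poly g \<Longrightarrow> int_quasi_poly (\<lambda>u. f u * g u)"
  by (rule int_quasi_poly_binop[where pop = "(*)"]) auto

lemma int_quasi_poly_sum:
  "(\<And>i. i \<in> I \<Longrightarrow> int_quasi_poly (f i)) \<Longrightarrow> int_quasi_poly (\<lambda>u. \<Sum>i\<in>I. f i u)"
  by (induction I rule: infinite_finite_induct) (auto intro: int_quasi_poly_add int_quasi_poly_const)

lemma int_quasi_poly_power: "int_quasi_poly f \<Longrightarrow> int_quasi_poly (\<lambda>u. f u ^ k)"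
  by (induction k) (auto intro: int_quasi_poly_mult int_quasi_poly_const)

lemma int_quasi_poly_shift:
  assumes "int_quasi_poly f" shows "int_quasi_poly (\<lambda>u. f (u + a))"
proof -
  obtain m P where m: "m > 0" "\<And>u. f u = poly (P (u mod m)) (of_int u)"
    using assms unfolding int_quasi_poly_def by blast
  show ?thesis
    by (rule int_quasi_polyI[of m _ "\<lambda>r. pcompose (P ((r + a) mod m)) [:of_int a, 1:]"])
       (use m in \<open>simp_all add: poly_pcompose mod_simps add.commute\<close>)
qed

lemma int_quasi_poly_dvd:
  assumes "m > 0" shows "int_quasi_poly (\<lambda>u. of_bool (m dvd a * u + r))"
proof (rule int_quasi_polyI[of m _ "\<lambda>s. [:of_bool (m dvd a * s + r):]"])
  fix u
  have "m dvd a * u + r \<longleftrightarrow> m dvd a * (u mod m) + r"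
    unfolding dvd_eq_mod_eq_0 by (metis mod_add_left_eq mod_mult_right_eq)
  then show "of_bool (m dvd a * u + r) = poly [:of_bool (m dvd a * (u mod m) + r):] (rat_of_int u)"
    by simp
qed (use assms in simp)

text \<open>
  Turns a sum over \<open>t\<close> with bounds on \<open>D * t\<close> into a sum over the multiples \<open>u = D * t\<close>, whose
  bounds are then linear forms without rounding; see \<open>sum_dilate\<close>.
\<close>

lemma int_quasi_poly_dilate:
  assumes "int_quasi_poly f" "D > 0"
  shows "int_quasi_poly (\<lambda>u. of_bool (D dvd u) * f (u div D))"
proof -
  obtain m P where m: "m > 0" "\<And>u. f u = poly (P (u mod m)) (of_int u)"
    using assms unfolding int_quasi_poly_def by blast
  let ?Q = "\<lambda>r. if D dvd r then pcompose (P (r div D)) [:0, 1 / of_int D:] else 0"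
  show ?thesis
  proof (rule int_quasi_polyI[of "D * m" _ ?Q])
    fix u
    have 1: "D dvd u mod (D * m) \<longleftrightarrow> D dvd u" by (simp add: dvd_mod_iff)
    have 2: "u mod (D * m) div D = (u div D) mod m"
      using m(1) assms(2) by (simp add: zmod_zmult2_eq)
    show "of_bool (D dvd u) * f (u div D) = poly (?Q (u mod (D * m))) (rat_of_int u)"
    proof (cases "D dvd u")
      case True
      then obtain v where "u = D * v" by blast
      then show ?thesis using 1 2 assms(2) m(2) by (simp add: poly_pcompose)
    qed (use 1 in simp)
  qed (use m assms in simp)
qed

text \<open>
  Monomials suffice, by linearity, and for them the top term of the difference of \<open>y ^ (a + 1)\<close> is
  a nonzero multiple of \<open>y ^ a\<close>, while the remaining terms have lower degree and are already
  solved.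
\<close>

lemma poly_difference_equation:
  fixes P :: "rat poly" and m :: rat
  assumes "m \<noteq> 0"
  shows "\<exists>p. \<forall>y. poly p (y + m) - poly p y = poly P y"
proof -
  have mono: "\<exists>p. \<forall>y. poly p (y + m) - poly p y = y ^ a" for a
  proof (induction a rule: less_induct)
    case (less a)
    then obtain p where p: "\<And>i y. i < a \<Longrightarrow> poly (p i) (y + m) - poly (p i) y = y ^ i"
      by metis
    let ?b = "\<lambda>i. of_nat (Suc a choose i) * m ^ (Suc a - i)"
    let ?p = "smult (1 / (of_nat (Suc a) * m)) (monom 1 (Suc a) - (\<Sum>i<a. smult (?b i) (p i)))"
    have "poly ?p (y + m) - poly ?p y = y ^ a" for y
    proof -
      have "(y + m) ^ Suc a = (\<Sum>i\<le>Suc a. ?b i * y ^ i)"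
        by (subst binomial_ring) (simp add: mult_ac)
      also have "\<dots> = (\<Sum>i<a. ?b i * y ^ i) + of_nat (Suc a) * m * y ^ a + y ^ Suc a"
        by (simp flip: lessThan_Suc_atMost)
      finally have 1: "(y + m) ^ Suc a - y ^ Suc a - (\<Sum>i<a. ?b i * y ^ i)
          = of_nat (Suc a) * m * y ^ a" by simp
      have 2: "(\<Sum>i<a. ?b i * y ^ i)
          = (\<Sum>i<a. ?b i * poly (p i) (y + m)) - (\<Sum>i<a. ?b i * poly (p i) y)"
        unfolding sum_subtractf[symmetric]
        by (rule sum.cong) (simp_all add: p[symmetric] right_diff_distrib)
      have "poly ?p (y + m) - poly ?p y = 1 / (of_nat (Suc a) * m) *
          ((y + m) ^ Suc a - y ^ Suc a - (\<Sum>i<a. ?b i * y ^ i))"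
      proof -
        have "c * (1 * A - B) - c * (1 * D - E) = c * (A - D - (B - E))" for c A B D E :: rat
          by (simp add: algebra_simps)
        then show ?thesis
          unfolding 2 by (simp only: poly_smult poly_diff poly_monom poly_sum)
      qed
      also have "\<dots> = y ^ a"
        unfolding 1 using assms by (simp add: field_simps del: of_nat_Suc)
      finally show ?thesis .
    qed
    then show ?case by blast
  qed
  then obtain p where p: "\<And>i y. poly (p i) (y + m) - poly (p i) y = y ^ i" by metis
  have "poly (\<Sum>i\<le>degree P. smult (coeff P i) (p i)) (y + m)
      - poly (\<Sum>i\<le>degree P. smult (coeff P i) (p i)) y = poly P y" for y
    by (simp add: poly_sum poly_altdef[of P] p[symmetric] right_diff_distrib sum_subtractf)
  then show ?thesis by blast
qed

text \<open>
  On each residue class solve the difference equation with step \<open>m\<close>, which gives \<open>h\<close> with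
  \<open>h (u + m) - h u = f u\<close>. The sum of \<open>h\<close> over the window \<open>{u..<u + m}\<close> then has difference \<open>f\<close>
  with step \<open>1\<close>, by telescoping.
\<close>

lemma int_quasi_poly_antidifference:
  assumes "int_quasi_poly f"
  obtains S where "int_quasi_poly S" "\<And>u. S (u + 1) - S u = f u"
proof -
  obtain m P where m: "m > 0" "\<And>u. f u = poly (P (u mod m)) (of_int u)"
    using assms unfolding int_quasi_poly_def by blast
  have "\<exists>p. \<forall>y. poly p (y + of_int m) - poly p y = poly (P r) y" for r
    using poly_difference_equation[of "of_int m" "P r"] m(1) by auto
  then obtain p where p: "\<And>r y. poly (p r) (y + of_int m) - poly (p r) y = poly (P r) y"
    by metis
  define h where "h u = poly (p (u mod m)) (of_int u)" for u
  have h: "int_quasi_poly h"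
    by (rule int_quasi_polyI[OF m(1)]) (simp add: h_def)
  define S where "S u = (\<Sum>j<nat m. h (u + int j))" for u
  show thesis
  proof
    show "int_quasi_poly S"
      unfolding S_def by (intro int_quasi_poly_sum int_quasi_poly_shift h)
    fix u
    have "S (u + 1) - S u = (\<Sum>j<nat m. h (u + int (Suc j)) - h (u + int j))"
      by (simp add: S_def sum_subtractf add_ac)
    also have "\<dots> = h (u + m) - h u"
      by (subst sum_lessThan_telescope) (use m in simp)
    also have "\<dots> = f u"
      using m(2) by (simp add: h_def p)
    finally show "S (u + 1) - S u = f u" .
  qed
qed

lemma sum_antidifference:
  fixes S :: "int \<Rightarrow> rat"
  assumes "\<And>u. S (u + 1) - S u = f u" "a \<le> b + 1"
  shows "(\<Sum>u=a..b. f u) = S (b + 1) - S a"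
proof -
  have "(\<Sum>u=a..a + int n - 1. f u) = S (a + int n) - S a" for n
  proof (induction n)
    case (Suc n)
    have "{a..a + int (Suc n) - 1} = insert (a + int n) {a..a + int n - 1}" by auto
    then show ?case using Suc assms(1)[of "a + int n"] by (simp add: algebra_simps)
  qed simp
  from this[of "nat (b + 1 - a)"] show ?thesis using assms(2) by simp
qed

text \<open>
  The bound is only required for arbitrarily large \<open>n\<close>, since the constituents of a
  quasi-polynomial are controlled on one residue class each.
\<close>

lemma poly_degree_le_of_growth:
  fixes p :: "rat poly"
  assumes "\<And>N. \<exists>n\<ge>N. \<bar>poly p (of_nat n)\<bar> \<le> C * of_nat (n + 1) ^ e"
  shows "degree p \<le> e"
proof (rule ccontr)
  assume "\<not> degree p \<le> e"
  then obtain d where d: "degree p = Suc d" "e \<le> d"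
    by (metis less_Suc_eq_le not_less gr0_implies_Suc bot_nat_0.not_eq_extremum not_less_zero)
  define A where "A = (\<Sum>i\<le>d. \<bar>coeff p i\<bar>)"
  define l where "l = \<bar>lead_coeff p\<bar>"
  have l: "l > 0" using d leading_coeff_neq_0[of p] by (fastforce simp: l_def)
  obtain N where N: "of_nat N > (A + \<bar>C\<bar> * 2 ^ e) / l" using reals_Archimedean2 by blast
  obtain n where n: "n \<ge> max N 1" "\<bar>poly p (of_nat n)\<bar> \<le> C * of_nat (n + 1) ^ e"
    using assms by blast
  let ?n = "of_nat n :: rat"
  have n1: "?n \<ge> 1" using n(1) by simp
  have "poly p ?n = (\<Sum>i\<le>d. coeff p i * ?n ^ i) + lead_coeff p * ?n ^ Suc d"
    by (simp add: poly_altdef d(1))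
  then have "l * ?n ^ Suc d \<le> \<bar>\<Sum>i\<le>d. coeff p i * ?n ^ i\<bar> + \<bar>poly p ?n\<bar>"
    by (simp add: l_def abs_mult[of _ "?n ^ Suc d"] flip: abs_mult)
  also have "\<bar>\<Sum>i\<le>d. coeff p i * ?n ^ i\<bar> \<le> (\<Sum>i\<le>d. \<bar>coeff p i\<bar> * ?n ^ d)"
    by (rule order_trans[OF sum_abs])
       (use n1 in \<open>auto intro!: sum_mono mult_left_mono power_increasing simp: abs_mult\<close>)
  also have "\<dots> = A * ?n ^ d" by (simp add: A_def sum_distrib_right)
  also have "\<bar>poly p ?n\<bar> \<le> \<bar>C\<bar> * (2 ^ e * ?n ^ d)"
  proof -
    have "of_nat (n + 1) ^ e \<le> (2 * ?n) ^ e" using n1 by (intro power_mono) auto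
    also have "\<dots> \<le> 2 ^ e * ?n ^ d"
      using n1 d(2) by (auto simp: power_mult_distrib intro!: power_increasing)
    finally have "\<bar>C\<bar> * of_nat (n + 1) ^ e \<le> \<bar>C\<bar> * (2 ^ e * ?n ^ d)"
      by (rule mult_left_mono) simp
    moreover have "C * of_nat (n + 1) ^ e \<le> \<bar>C\<bar> * of_nat (n + 1) ^ e"
      by (intro mult_right_mono) auto
    ultimately show ?thesis using n(2) by linarith
  qed
  finally have "(l * ?n) * ?n ^ d \<le> (A + \<bar>C\<bar> * 2 ^ e) * ?n ^ d"
    by (simp add: algebra_simps)
  then have "l * ?n \<le> A + \<bar>C\<bar> * 2 ^ e" using n1 by (simp add: mult_le_cancel_right)
  moreover have "A + \<bar>C\<bar> * 2 ^ e < l * ?n"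
  proof -
    have "l * of_nat N \<le> l * ?n" using n(1) l by (intro mult_left_mono) auto
    moreover have "A + \<bar>C\<bar> * 2 ^ e < l * of_nat N"
      using N l by (simp add: pos_divide_less_eq mult.commute)
    ultimately show ?thesis by linarith
  qed
  ultimately show False by simp
qed

section \<open>Quasi-polynomials on cones\<close>

text \<open>
  A point is a function on all of \<open>nat\<close>; coordinate \<open>0\<close> is reserved for the side length \<open>n\<close> of the
  box and the other coordinates are the variables to be summed over. Thus the number of
  variables may change during an elimination.
\<close>

inductive linear_form :: "((nat \<Rightarrow> int) \<Rightarrow> int) \<Rightarrow> bool" where
  var: "linear_form (\<lambda>x. x i)"
| add: "linear_form l \<Longrightarrow> linear_form l' \<Longrightarrow> linear_form (\<lambda>x. l x + l' x)"
| scale: "linear_form l \<Longrightarrow> linear_form (\<lambda>x. a * l x)"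

text \<open>
  Functions that are quasi-polynomial on each of finitely many polyhedral cones. The inequalities
  are homogeneous, while the congruences may have a constant term: this is stable under
  summation, and only the inequalities matter for a single formula on the whole ray \<open>n > 0\<close>. Strict
  inequalities are obtained as complements of non-strict ones.
\<close>

inductive conic_quasi_poly :: "((nat \<Rightarrow> int) \<Rightarrow> rat) \<Rightarrow> bool" where
  const: "conic_quasi_poly (\<lambda>x. a)"
| var: "conic_quasi_poly (\<lambda>x. of_int (x i))"
| nonneg: "linear_form l \<Longrightarrow> conic_quasi_poly (\<lambda>x. of_bool (l x \<ge> 0))"
| dvd: "linear_form l \<Longrightarrow> m > 0 \<Longrightarrow> conic_quasi_poly (\<lambda>x. of_bool (m dvd l x + r))"
| add: "conic_quasi_poly F \<Longrightarrow> conic_quasi_poly G \<Longrightarrow> conic_quasi_poly (\<lambda>x. F x + G x)"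
| mult: "conic_quasi_poly F \<Longrightarrow> conic_quasi_poly G \<Longrightarrow> conic_quasi_poly (\<lambda>x. F x * G x)"

lemma linear_form_diff:
  assumes "linear_form l" "linear_form l'" shows "linear_form (\<lambda>x. l x - l' x)"
  using linear_form.add[OF assms(1) linear_form.scale[OF assms(2), of "-1"]] by simp

lemma linear_form_zero: "linear_form (\<lambda>x. 0)"
  using linear_form.scale[OF linear_form.var, of 0] by simp

lemma conic_quasi_poly_diff:
  assumes "conic_quasi_poly F" "conic_quasi_poly G"
  shows "conic_quasi_poly (\<lambda>x. F x - G x)"
  using conic_quasi_poly.add[OF assms(1)
      conic_quasi_poly.mult[OF conic_quasi_poly.const assms(2)], of "-1"] by simp

lemma conic_quasi_poly_sum:
  "(\<And>i. i \<in> I \<Longrightarrow> conic_quasi_poly (F i)) \<Longrightarrow> conic_quasi_poly (\<lambda>x. \<Sum>i\<in>I. F i x)"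
  by (induction I rule: infinite_finite_induct)
     (auto intro: conic_quasi_poly.add conic_quasi_poly.const)

lemma conic_quasi_poly_power:
  "conic_quasi_poly F \<Longrightarrow> conic_quasi_poly (\<lambda>x. F x ^ k)"
  by (induction k) (auto intro: conic_quasi_poly.mult conic_quasi_poly.const)

lemma conic_quasi_poly_linear_form:
  "linear_form l \<Longrightarrow> conic_quasi_poly (\<lambda>x. of_int (l x))"
  by (induction rule: linear_form.induct) (auto intro: conic_quasi_poly.intros)

lemma conic_quasi_poly_not:
  assumes "conic_quasi_poly (\<lambda>x. of_bool (P x))"
  shows "conic_quasi_poly (\<lambda>x. of_bool (\<not> P x))"
  using conic_quasi_poly_diff[OF conic_quasi_poly.const assms, of 1]
  by (simp add: of_bool_not_iff)

lemma conic_quasi_poly_conj: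
  assumes "conic_quasi_poly (\<lambda>x. of_bool (P x))" "conic_quasi_poly (\<lambda>x. of_bool (Q x))"
  shows "conic_quasi_poly (\<lambda>x. of_bool (P x \<and> Q x))"
  using conic_quasi_poly.mult[OF assms] by (simp add: of_bool_conj)

lemma conic_quasi_poly_ball:
  assumes "finite A" "\<And>a. a \<in> A \<Longrightarrow> conic_quasi_poly (\<lambda>x. of_bool (P a x))"
  shows "conic_quasi_poly (\<lambda>x. of_bool (\<forall>a\<in>A. P a x))"
  using assms by (induction A rule: finite_induct)
    (auto intro: conic_quasi_poly_conj simp: conic_quasi_poly.const[of 1, simplified])

lemma conic_quasi_poly_eq:
  assumes "linear_form l" "linear_form l'"
  shows "conic_quasi_poly (\<lambda>x. of_bool (l x = l' x))"
proof -
  have "conic_quasi_poly (\<lambda>x. of_bool (l x - l' x \<ge> 0 \<and> l' x - l x \<ge> 0))"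
    by (intro conic_quasi_poly_conj conic_quasi_poly.nonneg linear_form_diff assms)
  moreover have "(l x - l' x \<ge> 0 \<and> l' x - l x \<ge> 0) = (l x = l' x)" for x by auto
  ultimately show ?thesis by simp
qed

text \<open>
  Needed to substitute the summation bounds into an antidifference.
\<close>

lemma conic_quasi_poly_compose:
  assumes "int_quasi_poly g" "linear_form l"
  shows "conic_quasi_poly (\<lambda>x. g (l x))"
proof -
  obtain m P where m: "m > 0" "\<And>u. g u = poly (P (u mod m)) (of_int u)"
    using assms(1) unfolding int_quasi_poly_def by blast
  have "g (l x) = (\<Sum>r\<in>{0..<m}. of_bool (m dvd l x + (- r)) *
      (\<Sum>i\<le>degree (P r). coeff (P r) i * of_int (l x) ^ i))" for x
  proof -
    have "(m dvd l x + (- r)) = (l x mod m = r)" if "r \<in> {0..<m}" for r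
      using that mod_eq_dvd_iff[of "l x" m r] by auto
    then have "(\<Sum>r\<in>{0..<m}. of_bool (m dvd l x + (- r)) *
        (\<Sum>i\<le>degree (P r). coeff (P r) i * of_int (l x) ^ i))
      = (\<Sum>r\<in>{0..<m}. if l x mod m = r then poly (P r) (of_int (l x)) else 0)"
      by (intro sum.cong) (auto simp: poly_altdef)
    also have "\<dots> = g (l x)" using m by (subst sum.delta') auto
    finally show ?thesis by simp
  qed
  moreover have "conic_quasi_poly (\<lambda>x. \<Sum>r\<in>{0..<m}. of_bool (m dvd l x + (- r)) *
      (\<Sum>i\<le>degree (P r). coeff (P r) i * of_int (l x) ^ i))"
    by (intro conic_quasi_poly_sum conic_quasi_poly.mult conic_quasi_poly.dvd assms m(1)
        conic_quasi_poly.const conic_quasi_poly_power conic_quasi_poly_linear_form)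
  ultimately show ?thesis by simp
qed

lemma linear_form_update:
  "linear_form l \<Longrightarrow> \<exists>c l'. linear_form l' \<and> (\<forall>x t. l (x(k := t)) = c * t + l' x)"
proof (induction rule: linear_form.induct)
  case (var i)
  show ?case
  proof (cases "i = k")
    case True
    then show ?thesis using linear_form_zero by (intro exI[of _ 1] exI[of _ "\<lambda>x. 0"]) auto
  next
    case False
    then show ?thesis by (intro exI[of _ 0] exI[of _ "\<lambda>x. x i"]) (auto intro: linear_form.var)
  qed
next
  case (add l l')
  then obtain c m c' m' where "linear_form m" "\<forall>x t. l (x(k := t)) = c * t + m x"
    "linear_form m'" "\<forall>x t. l' (x(k := t)) = c' * t + m' x" by blast
  then show ?case
    by (intro exI[of _ "c + c'"] exI[of _ "\<lambda>x. m x + m' x"])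
       (auto intro: linear_form.add simp: algebra_simps simp del: fun_upd_apply)
next
  case (scale l a)
  then obtain c m where "linear_form m" "\<forall>x t. l (x(k := t)) = c * t + m x" by blast
  then show ?case
    by (intro exI[of _ "a * c"] exI[of _ "\<lambda>x. a * m x"])
       (auto intro: linear_form.scale simp: algebra_simps simp del: fun_upd_apply)
qed

text \<open>
  Normal form of a function of the summation variable \<open>t\<close>: each summand has one lower bound and one
  upper bound for \<open>t\<close>. It has finite support in \<open>t\<close> for every \<open>x\<close>, so it can be summed over
  all integers.
\<close>

inductive sliced :: "(int \<Rightarrow> (nat \<Rightarrow> int) \<Rightarrow> rat) \<Rightarrow> bool" where
  slice: "conic_quasi_poly G \<Longrightarrow> int_quasi_poly g \<Longrightarrow> linear_form l \<Longrightarrow> linear_form l' \<Longrightarrow>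
    c > 0 \<Longrightarrow> d > 0 \<Longrightarrow> sliced (\<lambda>t x. G x * g t * of_bool (l x \<le> c * t \<and> d * t \<le> l' x))"
| add: "sliced T \<Longrightarrow> sliced U \<Longrightarrow> sliced (\<lambda>t x. T t x + U t x)"

lemma sliced_mult_conic:
  "sliced T \<Longrightarrow> conic_quasi_poly G \<Longrightarrow> sliced (\<lambda>t x. G x * T t x)"
proof (induction rule: sliced.induct)
  case (slice G' g l l' c d)
  show ?case
    using sliced.slice[OF conic_quasi_poly.mult[OF slice(7) slice(1)] slice(2-6)]
    by (simp add: mult.assoc)
next
  case (add T U)
  then show ?case using sliced.add by (simp add: distrib_left)
qed

lemma sliced_mult_quasi_poly:
  "sliced T \<Longrightarrow> int_quasi_poly g \<Longrightarrow> sliced (\<lambda>t x. g t * T t x)"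
proof (induction rule: sliced.induct)
  case (slice G g' l l' c d)
  show ?case
    using sliced.slice[OF slice(1) int_quasi_poly_mult[OF slice(7) slice(2)] slice(3-6)]
    by (simp add: mult_ac)
next
  case (add T U)
  then show ?case using sliced.add by (simp add: distrib_left)
qed

lemma sliced_sum:
  assumes "finite I" "I \<noteq> {}" "\<And>i. i \<in> I \<Longrightarrow> sliced (T i)"
  shows "sliced (\<lambda>t x. \<Sum>i\<in>I. T i t x)"
  using assms by (induction I rule: finite_ne_induct) (auto intro: sliced.add)

text \<open>
  A further bound on \<open>t\<close> is merged with the existing one: compare the two lower (or the two upper)
  bounds, which is a homogeneous condition on \<open>x\<close>, and keep the sharper one. Comparing
  after cross-multiplication avoids rounding, so that no constants enter the inequalities.
\<close>

lemma sliced_mult_nonneg: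
  assumes "sliced T" "linear_form m"
  shows "sliced (\<lambda>t x. of_bool (a * t + m x \<ge> 0) * T t x)"
  using assms(1)
proof (induction rule: sliced.induct)
  case (slice G g l l' c d)
  consider "a = 0" | "a > 0" | "a < 0" by linarith
  then show ?case
  proof cases
    case 1
    then show ?thesis
      using sliced_mult_conic[OF sliced.slice[OF slice] conic_quasi_poly.nonneg[OF assms(2)]]
      by simp
  next
    case 2
    have m': "linear_form (\<lambda>x. - m x)" using linear_form.scale[OF assms(2), of "-1"] by simp
    \<comment> \<open>\<open>H\<close> tells whether the new lower bound is the sharper one\<close>
    define H where "H x = (of_bool (c * (- m x) - a * l x \<ge> 0) :: rat)" for x
    have H: "conic_quasi_poly H"
      unfolding H_def using m' slice(3)
      by (intro conic_quasi_poly.nonneg linear_form_diff linear_form.scale)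
    have "sliced (\<lambda>t x. (H x * G x) * g t * of_bool (- m x \<le> a * t \<and> d * t \<le> l' x)
        + ((1 - H x) * G x) * g t * of_bool (l x \<le> c * t \<and> d * t \<le> l' x))"
      using slice 2 H m'
      by (intro sliced.add sliced.slice conic_quasi_poly.mult conic_quasi_poly_diff
          conic_quasi_poly.const)
    moreover have "(H x * G x) * g t * of_bool (- m x \<le> a * t \<and> d * t \<le> l' x)
        + ((1 - H x) * G x) * g t * of_bool (l x \<le> c * t \<and> d * t \<le> l' x)
      = of_bool (a * t + m x \<ge> 0) * (G x * g t * of_bool (l x \<le> c * t \<and> d * t \<le> l' x))" for t x
    proof (cases "c * (- m x) \<ge> a * l x")
      case True
      have "l x \<le> c * t" if "- m x \<le> a * t"
      proof -
        have "a * l x \<le> c * (a * t)"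
          using True mult_left_mono[OF that, of c] slice(5) by linarith
        then show ?thesis using 2 by (simp add: mult.left_commute)
      qed
      then show ?thesis using True by (auto simp: H_def of_bool_def)
    next
      case False
      have "- m x \<le> a * t" if "l x \<le> c * t"
      proof -
        have "c * (- m x) \<le> c * (a * t)"
          using False mult_left_mono[OF that, of a] 2 by (subst mult.left_commute) linarith
        then show ?thesis by (rule mult_left_le_imp_le[OF _ slice(5)])
      qed
      then show ?thesis using False by (auto simp: H_def of_bool_def)
    qed
    ultimately show ?thesis by simp
  next
    case 3
    define b where "b = - a"
    have b: "b > 0" "a = - b" using 3 by (auto simp: b_def)
    \<comment> \<open>\<open>H\<close> tells whether the new upper bound is the sharper one\<close>
    define H where "H x = (of_bool (b * l' x - d * m x \<ge> 0) :: rat)" for x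
    have H: "conic_quasi_poly H"
      unfolding H_def using assms(2) slice(4)
      by (intro conic_quasi_poly.nonneg linear_form_diff linear_form.scale)
    have "sliced (\<lambda>t x. (H x * G x) * g t * of_bool (l x \<le> c * t \<and> b * t \<le> m x)
        + ((1 - H x) * G x) * g t * of_bool (l x \<le> c * t \<and> d * t \<le> l' x))"
      using slice b(1) H assms(2)
      by (intro sliced.add sliced.slice conic_quasi_poly.mult conic_quasi_poly_diff
          conic_quasi_poly.const)
    moreover have "(H x * G x) * g t * of_bool (l x \<le> c * t \<and> b * t \<le> m x)
        + ((1 - H x) * G x) * g t * of_bool (l x \<le> c * t \<and> d * t \<le> l' x)
      = of_bool (a * t + m x \<ge> 0) * (G x * g t * of_bool (l x \<le> c * t \<and> d * t \<le> l' x))" for t x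
    proof (cases "b * l' x \<ge> d * m x")
      case True
      have "d * t \<le> l' x" if "b * t \<le> m x"
      proof -
        have "b * (d * t) \<le> b * l' x"
          using True mult_left_mono[OF that, of d] slice(6) by (subst mult.left_commute) linarith
        then show ?thesis by (rule mult_left_le_imp_le[OF _ b(1)])
      qed
      then show ?thesis using True b by (auto simp: H_def of_bool_def)
    next
      case False
      have "b * t \<le> m x" if "d * t \<le> l' x"
      proof -
        have "d * (b * t) \<le> d * m x"
          using False mult_left_mono[OF that, of b] b(1) by (subst mult.left_commute) linarith
        then show ?thesis by (rule mult_left_le_imp_le[OF _ slice(6)])
      qed
      then show ?thesis using False b by (auto simp: H_def of_bool_def)
    qed
    ultimately show ?thesis by simp
  qed
next
  case (add T U)
  then show ?case using sliced.add by (simp add: distrib_left)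
qed

text \<open>
  Split according to the residue \<open>s\<close> of the part of the linear form that does not involve \<open>t\<close>.
\<close>

lemma sliced_mult_dvd:
  assumes "sliced T" "linear_form m" "k > 0"
  shows "sliced (\<lambda>t x. of_bool (k dvd a * t + m x + r) * T t x)"
proof -
  have "sliced (\<lambda>t x. \<Sum>s\<in>{0..<k}. of_bool (k dvd m x + (r - s)) *
      (of_bool (k dvd a * t + s) * T t x))"
    using assms
    by (intro sliced_sum sliced_mult_conic sliced_mult_quasi_poly int_quasi_poly_dvd
        conic_quasi_poly.dvd) auto
  moreover have "(\<Sum>s\<in>{0..<k}. of_bool (k dvd m x + (r - s)) *
      (of_bool (k dvd a * t + s) * T t x)) = of_bool (k dvd a * t + m x + r) * T t x" for t x
  proof -
    have *: "k dvd m x + (r - s) \<longleftrightarrow> s = (m x + r) mod k" if "s \<in> {0..<k}" for s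
      using that mod_eq_dvd_iff[of "m x + r" k s] by (auto simp: algebra_simps)
    have "(\<Sum>s\<in>{0..<k}. of_bool (k dvd m x + (r - s)) * (of_bool (k dvd a * t + s) * T t x))
       = (\<Sum>s\<in>{0..<k}. if s = (m x + r) mod k then of_bool (k dvd a * t + s) * T t x else 0)"
      by (rule sum.cong) (simp_all add: *)
    also have "\<dots> = of_bool (k dvd a * t + (m x + r) mod k) * T t x"
      using assms(3) by (subst sum.delta) auto
    also have "k dvd a * t + (m x + r) mod k \<longleftrightarrow> k dvd a * t + m x + r"
      by (simp add: dvd_eq_mod_eq_0 mod_simps add.assoc)
    finally show ?thesis .
  qed
  ultimately show ?thesis by simp
qed

text \<open>
  The form with the arbitrary factor \<open>T\<close> is what makes products go through: the two factors are
  absorbed one after the other.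
\<close>

lemma sliced_mult_update:
  assumes "conic_quasi_poly F" "sliced T"
  shows "sliced (\<lambda>t x. F (x(k := t)) * T t x)"
  using assms
proof (induction arbitrary: T rule: conic_quasi_poly.induct)
  case (const a)
  show ?case by (intro sliced_mult_conic conic_quasi_poly.const const)
next
  case (var i)
  show ?case
  proof (cases "i = k")
    case True
    then show ?thesis using sliced_mult_quasi_poly[OF var int_quasi_poly_of_int] by simp
  next
    case False
    then show ?thesis using sliced_mult_conic[OF var conic_quasi_poly.var] by simp
  qed
next
  case (nonneg l)
  obtain c l' where "linear_form l'" "\<forall>x t. l (x(k := t)) = c * t + l' x"
    using linear_form_update[OF nonneg(1)] by blast
  then show ?case using sliced_mult_nonneg[OF nonneg(2)] by (simp del: fun_upd_apply)
next
  case (dvd l m r)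
  obtain c l' where "linear_form l'" "\<forall>x t. l (x(k := t)) = c * t + l' x"
    using linear_form_update[OF dvd(1)] by blast
  then show ?case using sliced_mult_dvd[OF dvd(3) _ dvd(2)] by (simp del: fun_upd_apply)
next
  case (add F G)
  show ?case using sliced.add[OF add(3,4)[OF add(5)]] by (simp add: distrib_right)
next
  case (mult F G)
  show ?case using mult(3)[OF mult(4)[OF mult(5)]] by (simp add: mult.assoc)
qed

lemma sum_dilate:
  fixes g :: "int \<Rightarrow> rat"
  assumes "D > 0"
  shows "(\<Sum>t | L \<le> D * t \<and> D * t \<le> U. g t) = (\<Sum>u=L..U. of_bool (D dvd u) * g (u div D))"
proof -
  have "(\<Sum>u=L..U. of_bool (D dvd u) * g (u div D)) = (\<Sum>u\<in>{u\<in>{L..U}. D dvd u}. g (u div D))"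
    by (intro sum.mono_neutral_cong_right) auto
  also have "\<dots> = (\<Sum>t | L \<le> D * t \<and> D * t \<le> U. g t)"
    using assms by (intro sum.reindex_bij_witness[of _ "\<lambda>t. D * t" "\<lambda>u. u div D"]) auto
  finally show ?thesis by simp
qed

text \<open>
  The support of a slice is an interval in \<open>u = c * d * t\<close> whose end points are linear forms, so its
  sum is the difference of an antidifference at these end points, provided that the interval is
  nonempty, which is a homogeneous inequality. The partial sums over \<open>{-M..M}\<close> are eventually
  constant; stating it so makes the passage to sums of slices immediate.
\<close>

lemma sliced_summation:
  assumes "sliced T"
  shows "\<exists>H. conic_quasi_poly H \<and> (\<forall>x. \<forall>\<^sub>F M in at_top. (\<Sum>t=-M..M. T t x) = H x)"
  using assms
proof (induction rule: sliced.induct)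
  case (slice G g l l' c d)
  \<comment> \<open>with \<open>u = c * d * t\<close> the bounds become \<open>d * l x \<le> u\<close> and \<open>u \<le> c * l\' x\<close>\<close>
  let ?\<psi> = "\<lambda>u. of_bool (c * d dvd u) * g (u div (c * d))"
  have cd: "c * d > 0" using slice by simp
  obtain S where S: "int_quasi_poly S" "\<And>u. S (u + 1) - S u = ?\<psi> u"
    using int_quasi_poly_antidifference[OF int_quasi_poly_dilate[OF slice(2) cd]] by blast
  define H where "H x = G x * (of_bool (c * l' x - d * l x \<ge> 0) *
      (S (c * l' x + 1) - S (d * l x)))" for x
  have "conic_quasi_poly H"
    unfolding H_def using slice S(1)
    by (intro conic_quasi_poly.mult conic_quasi_poly_diff conic_quasi_poly.nonneg
        linear_form_diff linear_form.scale conic_quasi_poly_compose[of "\<lambda>u. S (u + 1)"]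
        conic_quasi_poly_compose[of S] int_quasi_poly_shift)
  moreover have "\<forall>\<^sub>F M in at_top. (\<Sum>t=-M..M. G x * g t *
      of_bool (l x \<le> c * t \<and> d * t \<le> l' x)) = H x" for x
  proof -
    let ?R = "{t. l x \<le> c * t \<and> d * t \<le> l' x}"
    have R: "?R = {t. d * l x \<le> c * d * t \<and> c * d * t \<le> c * l' x}"
    proof -
      have "d * l x \<le> c * d * t \<longleftrightarrow> l x \<le> c * t" "c * d * t \<le> c * l' x \<longleftrightarrow> d * t \<le> l' x" for t
        using slice(5,6) mult_le_cancel_left_pos[of d "l x" "c * t"] by (simp_all add: mult_ac)
      then show ?thesis by simp
    qed
    have "(\<Sum>t\<in>?R. g t) = of_bool (c * l' x - d * l x \<ge> 0) * (S (c * l' x + 1) - S (d * l x))"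
      unfolding R sum_dilate[OF cd]
    proof (cases "d * l x \<le> c * l' x")
      case True
      then show "(\<Sum>u=d * l x..c * l' x. ?\<psi> u) =
          of_bool (c * l' x - d * l x \<ge> 0) * (S (c * l' x + 1) - S (d * l x))"
        using sum_antidifference[of S ?\<psi>, OF S(2), of "d * l x" "c * l' x"] by simp
    qed simp
    then have RH: "(\<Sum>t\<in>?R. G x * g t) = H x"
      by (simp add: H_def sum_distrib_left[symmetric])
    have "(\<Sum>t=-M..M. G x * g t * of_bool (l x \<le> c * t \<and> d * t \<le> l' x)) = H x"
      if M: "M \<ge> \<bar>l x\<bar> + \<bar>l' x\<bar>" for M
    proof -
      have "?R \<subseteq> {-M..M}"
      proof
        fix t assume t: "t \<in> ?R"
        have "- M \<le> t"
        proof (rule ccontr)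
          assume "\<not> - M \<le> t"
          then have "t < 0" "t < l x" using M by auto
          moreover from this have "c * t \<le> t" using slice(5) mult_right_mono_neg[of 1 c t] by simp
          moreover have "l x \<le> c * t" using t by simp
          ultimately show False by linarith
        qed
        moreover have "t \<le> M"
        proof (rule ccontr)
          assume "\<not> t \<le> M"
          then have "t > 0" "t > l' x" using M by auto
          moreover from this have "d * t \<ge> t" using slice(6) mult_right_mono[of 1 d t] by simp
          moreover have "d * t \<le> l' x" using t by simp
          ultimately show False by linarith
        qed
        ultimately show "t \<in> {-M..M}" by simp
      qed
      then have "(\<Sum>t\<in>?R. G x * g t) = (\<Sum>t=-M..M. G x * g t * of_bool (t \<in> ?R))"
        by (intro sum.mono_neutral_cong_left) auto
      then show ?thesis using RH by simp
    qed
    then show ?thesis using eventually_at_top_linorder by blast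
  qed
  ultimately show ?case by blast
next
  case (add T U)
  then obtain H K where "conic_quasi_poly H" "\<And>x. \<forall>\<^sub>F M in at_top. (\<Sum>t=-M..M. T t x) = H x"
    "conic_quasi_poly K" "\<And>x. \<forall>\<^sub>F M in at_top. (\<Sum>t=-M..M. U t x) = K x" by blast
  moreover from this have "\<forall>\<^sub>F M in at_top. (\<Sum>t=-M..M. T t x + U t x) = H x + K x" for x
    using eventually_conj[of "\<lambda>M. (\<Sum>t=-M..M. T t x) = H x" at_top
        "\<lambda>M. (\<Sum>t=-M..M. U t x) = K x"]
    by (auto simp: sum.distrib elim: eventually_mono)
  ultimately show ?case
    by (intro exI[of _ "\<lambda>x. H x + K x"]) (auto intro: conic_quasi_poly.add)
qed

lemma conic_quasi_poly_sum_variable: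
  assumes "conic_quasi_poly F"
  shows "conic_quasi_poly (\<lambda>x. \<Sum>t=0..x 0. F (x(k := t)))"
proof -
  have "sliced (\<lambda>t x. 1 * 1 * of_bool (0 \<le> 1 * t \<and> 1 * t \<le> x 0))"
    by (intro sliced.slice conic_quasi_poly.const int_quasi_poly_const linear_form_zero
        linear_form.var) simp_all
  from sliced_summation[OF sliced_mult_update[OF assms this, of k]] obtain H
    where H: "conic_quasi_poly H" "\<And>x. \<forall>\<^sub>F M in at_top.
      (\<Sum>t=-M..M. F (x(k := t)) * of_bool (0 \<le> t \<and> t \<le> x 0)) = H x" by auto
  have "(\<Sum>t=0..x 0. F (x(k := t))) = H x" for x
  proof -
    obtain M where M: "M \<ge> x 0" "M \<ge> 0"
      "(\<Sum>t=-M..M. F (x(k := t)) * of_bool (0 \<le> t \<and> t \<le> x 0)) = H x"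
      using eventually_happens[OF eventually_conj[OF eventually_ge_at_top[of "max (x 0) 0"] H(2)[of x]]]
      by auto
    have "(\<Sum>t=0..x 0. F (x(k := t))) = (\<Sum>t=-M..M. F (x(k := t)) * of_bool (0 \<le> t \<and> t \<le> x 0))"
      using M by (intro sum.mono_neutral_cong_left) auto
    then show ?thesis using M by simp
  qed
  then show ?thesis using H(1) by simp
qed

lemma conic_quasi_poly_sum_box:
  assumes "finite K" "0 \<notin> K" "conic_quasi_poly F"
  shows "conic_quasi_poly (\<lambda>x. \<Sum>y \<in> K \<rightarrow>\<^sub>E {0..x 0}. F (override_on x y K))"
  using assms
proof (induction K arbitrary: F rule: finite_induct)
  case empty
  then show ?case by simp
next
  case (insert k K)
  let ?F = "\<lambda>x. \<Sum>y \<in> K \<rightarrow>\<^sub>E {0..x 0}. F (override_on x y K)"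
  have "conic_quasi_poly (\<lambda>x. \<Sum>t=0..x 0. ?F (x(k := t)))"
    using insert by (intro conic_quasi_poly_sum_variable) auto
  moreover have "(\<Sum>t=0..x 0. ?F (x(k := t))) =
      (\<Sum>y \<in> insert k K \<rightarrow>\<^sub>E {0..x 0}. F (override_on x y (insert k K)))" for x
  proof -
    have "(\<Sum>y \<in> insert k K \<rightarrow>\<^sub>E {0..x 0}. F (override_on x y (insert k K)))
      = (\<Sum>(t, y) \<in> {0..x 0} \<times> (K \<rightarrow>\<^sub>E {0..x 0}). F (override_on x (y(k := t)) (insert k K)))"
      unfolding PiE_insert_eq
      by (subst sum.reindex[OF inj_combinator[OF insert(2)]]) (simp add: case_prod_unfold)
    also have "\<dots> = (\<Sum>t=0..x 0. \<Sum>y \<in> K \<rightarrow>\<^sub>E {0..x 0}. F (override_on (x(k := t)) y K))"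
    proof -
      have "override_on x (y(k := t)) (insert k K) = override_on (x(k := t)) y K" for t y
        using insert(2) by (auto simp: override_on_def fun_eq_iff)
      then show ?thesis by (simp add: sum.cartesian_product)
    qed
    also have "\<dots> = (\<Sum>t=0..x 0. ?F (x(k := t)))" using insert(4) by simp
    finally show ?thesis by simp
  qed
  ultimately show ?case by simp
qed

text \<open>
  A linear form restricted to the ray is \<open>c * n\<close>, so an inequality holds for all \<open>n > 0\<close> or for
  none. At \<open>n = 0\<close> it always holds, and the formula may fail there.
\<close>

lemma conic_quasi_poly_on_ray:
  assumes "conic_quasi_poly F"
  shows "\<exists>g. int_quasi_poly g \<and> (\<forall>n>0. F (\<lambda>i. if i = 0 then n else 0) = g n)"
proof -
  let ?e = "\<lambda>n i :: nat. if i = 0 then n else 0 :: int"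
  have lin: "\<exists>c. \<forall>n. l (?e n) = c * n" if "linear_form l" for l
    using that
  proof (induction rule: linear_form.induct)
    case (var i)
    show ?case by (rule exI[of _ "if i = 0 then 1 else 0"]) simp
  next
    case (add l l')
    then obtain c c' where "\<forall>n. l (?e n) = c * n" "\<forall>n. l' (?e n) = c' * n" by blast
    then show ?case by (intro exI[of _ "c + c'"]) (simp add: algebra_simps)
  next
    case (scale l a)
    then obtain c where "\<forall>n. l (?e n) = c * n" by blast
    then show ?case by (intro exI[of _ "a * c"]) (simp add: algebra_simps)
  qed
  show ?thesis using assms
  proof (induction rule: conic_quasi_poly.induct)
    case (const a)
    show ?case using int_quasi_poly_const by (intro exI[of _ "\<lambda>_. a"]) simp
  next
    case (var i)
    show ?case
    proof (cases "i = 0")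
      case True
      then show ?thesis using int_quasi_poly_of_int by (intro exI[of _ of_int]) simp
    next
      case False
      then show ?thesis using int_quasi_poly_const by (intro exI[of _ "\<lambda>_. 0"]) simp
    qed
  next
    case (nonneg l)
    then obtain c where "\<And>n. l (?e n) = c * n" using lin by blast
    then show ?case
      by (intro exI[of _ "\<lambda>_. of_bool (c \<ge> 0)"])
         (auto intro: int_quasi_poly_const simp: zero_le_mult_iff)
  next
    case (dvd l m r)
    then obtain c where "\<And>n. l (?e n) = c * n" using lin by blast
    then show ?case
      by (intro exI[of _ "\<lambda>n. of_bool (m dvd c * n + r)"]) (auto intro: int_quasi_poly_dvd dvd)
  next
    case (add F G)
    then obtain f g where "int_quasi_poly f" "\<forall>n>0. F (?e n) = f n"
      "int_quasi_poly g" "\<forall>n>0. G (?e n) = g n" by blast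
    then show ?case by (intro exI[of _ "\<lambda>n. f n + g n"]) (auto intro: int_quasi_poly_add)
  next
    case (mult F G)
    then obtain f g where "int_quasi_poly f" "\<forall>n>0. F (?e n) = f n"
      "int_quasi_poly g" "\<forall>n>0. G (?e n) = g n" by blast
    then show ?case by (intro exI[of _ "\<lambda>n. f n * g n"]) (auto intro: int_quasi_poly_mult)
  qed
qed

section \<open>Counting Sidon tuples for a fixed size\<close>

text \<open>
  The Sidon condition together with distinctness of the entries, for a family instead of a set. As
  a condition on indices it is linear in \<open>y\<close> and meaningful for subfamilies.
\<close>

definition distinct_sums :: "('a \<Rightarrow> int) \<Rightarrow> 'a set \<Rightarrow> bool" where
  "distinct_sums y J \<longleftrightarrow>
     (\<forall>a\<in>J. \<forall>b\<in>J. \<forall>c\<in>J. \<forall>d\<in>J. y a + y b = y c + y d \<longrightarrow> (a = c \<and> b = d) \<or> (a = d \<and> b = c))"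

lemma distinct_sumsD:
  assumes "distinct_sums y J" "a \<in> J" "b \<in> J" "c \<in> J" "d \<in> J" "y a + y b = y c + y d"
  shows "(a = c \<and> b = d) \<or> (a = d \<and> b = c)"
  using assms unfolding distinct_sums_def by blast

lemma distinct_sums_cong:
  "(\<And>i. i \<in> J \<Longrightarrow> y i = z i) \<Longrightarrow> distinct_sums y J \<longleftrightarrow> distinct_sums z J"
  by (simp add: distinct_sums_def)

text \<open>
  Equal differences become equal sums when terms are moved across; distinctness of the entries is
  the case \<open>y a + y a = y b + y b\<close>.
\<close>

lemma sidon_set_image_iff:
  assumes "finite J"
  shows "inj_on y J \<and> sidon_set (y ` J) \<longleftrightarrow> distinct_sums y J"
proof
  assume *: "inj_on y J \<and> sidon_set (y ` J)"
  have diff: "u = u'"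
    if "v - u = v' - u'" "u < v" "{u, v, u', v'} \<subseteq> y ` J" for u v u' v'
  proof -
    have "(u, v) = (u', v')"
      by (rule inj_onD[of "\<lambda>(a, b). b - a" "{(a, b). a \<in> y ` J \<and> b \<in> y ` J \<and> a < b}"])
         (use * that in \<open>auto simp: sidon_set_def\<close>)
    then show ?thesis by simp
  qed
  show "distinct_sums y J"
    unfolding distinct_sums_def
  proof (intro ballI impI)
    fix a b c d
    assume J: "a \<in> J" "b \<in> J" "c \<in> J" "d \<in> J" and eq: "y a + y b = y c + y d"
    have "(y a = y c \<and> y b = y d) \<or> (y a = y d \<and> y b = y c)"
    proof -
      consider "y a = y c" | "y a < y c" | "y a > y c" by linarith
      then show ?thesis
      proof cases
        case 2
        then have "y a = y d" using diff[of "y c" "y a" "y b" "y d"] J eq by auto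
        then show ?thesis using eq by simp
      next
        case 3
        then have "y c = y b" using diff[of "y a" "y c" "y d" "y b"] J eq by auto
        then show ?thesis using eq by simp
      qed (use eq in simp)
    qed
    then show "(a = c \<and> b = d) \<or> (a = d \<and> b = c)"
      using * J by (meson inj_onD)
  qed
next
  assume *: "distinct_sums y J"
  have "inj_on y J"
    using distinct_sumsD[OF *, of a a b b for a b] by (force intro: inj_onI)
  moreover have "inj_on (\<lambda>(u, v). v - u) {(u, v). u \<in> y ` J \<and> v \<in> y ` J \<and> u < v}"
  proof (rule inj_onI, clarify)
    fix a b c d
    assume J: "a \<in> J" "b \<in> J" "c \<in> J" "d \<in> J" and lt: "y a < y b" "y c < y d"
      and eq: "y b - y a = y d - y c"
    have "(b = d \<and> c = a) \<or> (b = a \<and> c = d)"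
      using distinct_sumsD[OF *, of b c d a] J eq by auto
    then show "y a = y c \<and> y b = y d" using lt by auto
  qed
  ultimately show "inj_on y J \<and> sidon_set (y ` J)"
    using assms by (simp add: sidon_set_def)
qed

definition sidon_maps :: "'a set \<Rightarrow> nat \<Rightarrow> ('a \<Rightarrow> int) set" where
  "sidon_maps J n = {y \<in> J \<rightarrow>\<^sub>E {0..int n}. distinct_sums y J}"

lemma finite_sidon_maps: "finite J \<Longrightarrow> finite (sidon_maps J n)"
  unfolding sidon_maps_def by (rule finite_subset[of _ "J \<rightarrow>\<^sub>E {0..int n}"]) (auto intro: finite_PiE)

text \<open>
  In particular the number of Sidon families depends only on the size of the index set.
\<close>

lemma card_sidon_maps:
  assumes "finite J"
  shows "card (sidon_maps J n) = card (ordered_sidon_sets (card J) n)"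
proof -
  define q where "q = card J"
  obtain h where h: "bij_betw h {..<q} J"
    using ex_bij_betw_nat_finite[OF assms] unfolding q_def atLeast0LessThan by blast
  define G where "G y = map (\<lambda>i. y (h i)) [0..<q]" for y :: "'a \<Rightarrow> int"
  have img: "h ` {..<q} = J" and inj: "inj_on h {..<q}"
    using h by (auto simp: bij_betw_def)
  have set_G: "set (G y) = y ` J" for y
    using img by (auto simp: G_def)
  have distinct_G: "distinct (G y) \<longleftrightarrow> inj_on y J" for y
    using comp_inj_on_iff[OF inj, of y] by (simp add: G_def distinct_map img comp_def atLeast0LessThan)
  have mem: "G y \<in> ordered_sidon_sets q n \<longleftrightarrow> y \<in> J \<rightarrow> {0..int n} \<and> distinct_sums y J" for y
    unfolding ordered_sidon_sets_def mem_Collect_eq distinct_G set_G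
      sidon_set_image_iff[OF assms, symmetric]
    by (auto simp: G_def)
  have "bij_betw G (sidon_maps J n) (ordered_sidon_sets q n)"
    unfolding bij_betw_def
  proof
    show "inj_on G (sidon_maps J n)"
    proof (rule inj_onI)
      fix y z assume yz: "y \<in> sidon_maps J n" "z \<in> sidon_maps J n" and eq: "G y = G z"
      have "y (h i) = z (h i)" if "i < q" for i
        using arg_cong[OF eq, of "\<lambda>s. s ! i"] that by (simp add: G_def)
      then have "y j = z j" if "j \<in> J" for j using that img by auto
      then show "y = z" using yz by (auto simp: sidon_maps_def intro: PiE_ext)
    qed
    show "G ` sidon_maps J n = ordered_sidon_sets q n"
    proof
      show "G ` sidon_maps J n \<subseteq> ordered_sidon_sets q n"
        using mem by (auto simp: sidon_maps_def PiE_def)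
      show "ordered_sidon_sets q n \<subseteq> G ` sidon_maps J n"
      proof
        fix s assume s: "s \<in> ordered_sidon_sets q n"
        then have len: "length s = q" by (simp add: ordered_sidon_sets_def)
        define y where "y = restrict (\<lambda>j. s ! the_inv_into {..<q} h j) J"
        have "y (h i) = s ! i" if "i < q" for i
          using that img by (auto simp: y_def the_inv_into_f_f[OF inj])
        then have G: "G y = s" using len by (auto simp: G_def intro: nth_equalityI)
        then have "y \<in> sidon_maps J n"
          using s mem[of y] by (auto simp: sidon_maps_def PiE_def y_def)
        then show "s \<in> G ` sidon_maps J n" using G by blast
      qed
    qed
  qed
  then show ?thesis unfolding q_def by (rule bij_betw_same_card)
qed

text \<open>
  Families without the value \<open>0\<close> are the translates by \<open>1\<close> of the families in the smaller box.
\<close>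

lemma card_sidon_maps_zero_attained:
  assumes "finite J"
  shows "card {y \<in> sidon_maps J (Suc n). \<exists>i\<in>J. y i = 0} + card (sidon_maps J n)
    = card (sidon_maps J (Suc n))"
proof -
  let ?A = "{y \<in> sidon_maps J (Suc n). \<exists>i\<in>J. y i = 0}"
  let ?B = "{y \<in> sidon_maps J (Suc n). \<not> (\<exists>i\<in>J. y i = 0)}"
  have "bij_betw (\<lambda>y. restrict (\<lambda>i. y i + 1) J) (sidon_maps J n) ?B"
  proof (rule bij_betw_byWitness[where f' = "\<lambda>y. restrict (\<lambda>i. y i - 1) J"])
    show "\<forall>y\<in>sidon_maps J n. (\<lambda>i\<in>J. (\<lambda>i\<in>J. y i + 1) i - 1) = y"
      by (auto simp: sidon_maps_def PiE_def extensional_def fun_eq_iff)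
    show "\<forall>y\<in>?B. (\<lambda>i\<in>J. (\<lambda>i\<in>J. y i - 1) i + 1) = y"
      by (auto simp: sidon_maps_def PiE_def extensional_def fun_eq_iff)
    show "(\<lambda>y. \<lambda>i\<in>J. y i + 1) ` sidon_maps J n \<subseteq> ?B"
      by (force simp: sidon_maps_def distinct_sums_def PiE_iff)
    show "(\<lambda>y. \<lambda>i\<in>J. y i - 1) ` ?B \<subseteq> sidon_maps J n"
      by (force simp: sidon_maps_def distinct_sums_def PiE_iff)
  qed
  then have "card (sidon_maps J n) = card ?B" by (rule bij_betw_same_card)
  moreover have "card (?A \<union> ?B) = card ?A + card ?B"
    using finite_sidon_maps[OF assms, of "Suc n"] by (intro card_Un_disjoint) auto
  moreover have "?A \<union> ?B = sidon_maps J (Suc n)" by blast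
  ultimately show ?thesis by simp
qed

lemma conic_quasi_poly_distinct_sums:
  assumes "finite K"
  shows "conic_quasi_poly (\<lambda>x. of_bool (distinct_sums x K))"
proof -
  have imp: "conic_quasi_poly (\<lambda>x. of_bool (x a + x b = x c + x d \<longrightarrow> P))"
    for a b c d and P
    using conic_quasi_poly_not[OF conic_quasi_poly_eq[OF linear_form.add[OF linear_form.var
      linear_form.var] linear_form.add[OF linear_form.var linear_form.var]], of a b c d]
      conic_quasi_poly.const[of 1]
    by (cases P) auto
  show ?thesis
    unfolding distinct_sums_def by (intro conic_quasi_poly_ball assms imp)
qed

text \<open>
  The increments \<open>f\<^sub>q(n) - f\<^sub>q(n - 1)\<close> are quasi-polynomial for \<open>n > 0\<close>, because they count
  points under homogeneous conditions. Summing them up yields a formula for \<open>f\<^sub>q\<close> that holds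
  at \<open>n = 0\<close> too, since it starts from the value \<open>f\<^sub>q(0)\<close>, whatever that is.
\<close>

lemma card_ordered_sidon_sets_quasi_poly:
  "\<exists>g. int_quasi_poly g \<and> (\<forall>n. of_nat (card (ordered_sidon_sets q n)) = g (int n))"
proof -
  let ?K = "{1..q}"
  let ?f = "\<lambda>n. of_nat (card (ordered_sidon_sets q n)) :: rat"
  define F :: "(nat \<Rightarrow> int) \<Rightarrow> rat" where
    "F x = of_bool (distinct_sums x ?K \<and> \<not> (\<forall>i\<in>?K. \<not> x i = 0))" for x
  have zero: "conic_quasi_poly (\<lambda>x. of_bool (x i = 0))" for i
    by (rule conic_quasi_poly_eq[OF linear_form.var linear_form_zero])
  have "conic_quasi_poly F"
    unfolding F_def
    by (intro conic_quasi_poly_conj conic_quasi_poly_distinct_sums conic_quasi_poly_not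
        conic_quasi_poly_ball zero) auto
  then have "conic_quasi_poly (\<lambda>x. \<Sum>y \<in> ?K \<rightarrow>\<^sub>E {0..x 0}. F (override_on x y ?K))"
    by (intro conic_quasi_poly_sum_box) auto
  from conic_quasi_poly_on_ray[OF this] obtain h where h: "int_quasi_poly h"
    "\<And>n. n > 0 \<Longrightarrow> (\<Sum>y \<in> ?K \<rightarrow>\<^sub>E {0..n}. F (override_on (\<lambda>i. if i = 0 then n else 0) y ?K)) = h n"
    by auto
  obtain S where S: "int_quasi_poly S" "\<And>u. S (u + 1) - S u = h u"
    using int_quasi_poly_antidifference[OF h(1)] by blast
  have step: "?f (Suc n) = ?f n + h (int (Suc n))" for n
  proof -
    \<comment> \<open>all coordinates that \<open>F\<close> reads are overridden, so it is a function of \<open>y\<close> alone\<close>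
    have over: "F (override_on x y ?K) = of_bool (distinct_sums y ?K \<and> (\<exists>i\<in>?K. y i = 0))" for x y
      by (auto simp: F_def distinct_sums_def)
    have "h (int (Suc n)) = (\<Sum>y \<in> ?K \<rightarrow>\<^sub>E {0..int (Suc n)}.
        of_bool (distinct_sums y ?K \<and> (\<exists>i\<in>?K. y i = 0)))"
      using h(2)[of "int (Suc n)"] unfolding over by simp
    also have "\<dots> = of_nat (card {y \<in> sidon_maps ?K (Suc n). \<exists>i\<in>?K. y i = 0})"
    proof -
      have "finite (?K \<rightarrow>\<^sub>E {0..int (Suc n)})" by (intro finite_PiE) auto
      moreover have "{y \<in> sidon_maps ?K (Suc n). \<exists>i\<in>?K. y i = 0} =
          (?K \<rightarrow>\<^sub>E {0..int (Suc n)}) \<inter> {y. distinct_sums y ?K \<and> (\<exists>i\<in>?K. y i = 0)}"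
        by (auto simp: sidon_maps_def)
      ultimately show ?thesis by (simp only: sum_of_bool_eq)
    qed
    finally show ?thesis
      using card_sidon_maps_zero_attained[of ?K n] card_sidon_maps[of ?K]
      by (simp flip: of_nat_add)
  qed
  have "?f n = ?f 0 - S 1 + S (int n + 1)" for n
  proof (induction n)
    case (Suc n)
    then show ?case using step[of n] S(2)[of "int (Suc n)"] by (simp add: algebra_simps)
  qed simp
  moreover have "int_quasi_poly (\<lambda>u. ?f 0 - S 1 + S (u + 1))"
    by (intro int_quasi_poly_add int_quasi_poly_const int_quasi_poly_shift S(1))
  ultimately show ?thesis by blast
qed

section \<open>The Moebius transform of the counting functions\<close>

lemma sum_Pow_card:
  fixes g :: "nat \<Rightarrow> 'b::comm_semiring_1"
  assumes "finite K"
  shows "(\<Sum>J\<in>Pow K. g (card J)) = (\<Sum>j\<le>card K. of_nat (card K choose j) * g j)"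
proof -
  have "(\<Sum>J\<in>Pow K. g (card J)) = (\<Sum>j\<le>card K. \<Sum>J\<in>{J\<in>Pow K. card J = j}. g (card J))"
    using assms by (intro sum.group[symmetric]) (auto intro: card_mono)
  also have "\<dots> = (\<Sum>j\<le>card K. of_nat (card K choose j) * g j)"
    using assms by (intro sum.cong) (auto simp: n_subsets[symmetric])
  finally show ?thesis .
qed

lemma sum_Pow_insert:
  assumes "finite L" "k \<notin> L"
  shows "(\<Sum>J\<in>Pow (insert k L). g J) = (\<Sum>J\<in>Pow L. g J + g (insert k J))"
proof -
  have inj: "inj_on (insert k) (Pow L)" using assms(2) by (auto intro!: inj_onI)
  have "(\<Sum>J\<in>Pow (insert k L). g J) = sum g (Pow L) + sum g (insert k ` Pow L)"
    unfolding Pow_insert using assms by (intro sum.union_disjoint) auto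
  then show ?thesis by (simp add: sum.reindex[OF inj] sum.distrib)
qed

text \<open>
  The Moebius transform, over the subsets of a \<open>k\<close>-element index set, of the number of points of
  \<open>{0..n}\<^sup>k\<close> that are Sidon on the subset. The sign is written \<open>(-1) ^ (k + j)\<close> instead of
  \<open>(-1) ^ (k - j)\<close> to avoid truncated subtraction.
\<close>

definition sidon_defect :: "nat \<Rightarrow> nat \<Rightarrow> rat" where
  "sidon_defect k n = (\<Sum>j\<le>k. of_nat (k choose j) * ((-1) ^ (k + j) * of_nat (n + 1) ^ (k - j)
     * of_nat (card (ordered_sidon_sets j n))))"

text \<open>
  Moebius inversion on the subset lattice, applied to \<open>f\<^sub>j(n) / (n + 1) ^ j\<close>: after this
  normalisation the indices outside a subset have weight \<open>1\<close>.
\<close>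

lemma card_ordered_sidon_sets_eq_sum_defect:
  "of_nat (card (ordered_sidon_sets q n)) =
     (\<Sum>k\<le>q. of_nat (q choose k) * (of_nat (n + 1) ^ (q - k) * sidon_defect k n))"
proof -
  let ?N = "of_nat (n + 1) :: rat"
  have N: "?N \<noteq> 0" by linarith
  define v where "v j = of_nat (card (ordered_sidon_sets j n)) / ?N ^ j" for j
  define w where "w j = sidon_defect j n / ?N ^ j" for j
  have w: "(-1) ^ card S * w (card S) = (\<Sum>T\<in>Pow S. (-1) ^ card T * v (card T))"
    if "finite S" for S :: "nat set"
  proof -
    have "(-1) ^ k * w k = (\<Sum>j\<le>k. of_nat (k choose j) * ((-1) ^ j * v j))" for k
      unfolding w_def v_def sidon_defect_def sum_divide_distrib sum_distrib_left
    proof (rule sum.cong[OF refl])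
      fix j assume "j \<in> {..k}"
      then have "?N ^ k = ?N ^ (k - j) * ?N ^ j" by (simp flip: power_add)
      then have 1: "?N ^ (k - j) / ?N ^ k = 1 / ?N ^ j" using N by simp
      have 2: "(-1) ^ k * (-1) ^ (k + j) = ((-1) ^ j :: rat)"
        by (simp add: power_add flip: mult.assoc power_mult_distrib)
      let ?F = "of_nat (card (ordered_sidon_sets j n)) :: rat" and ?C = "of_nat (k choose j) :: rat"
      have "(-1) ^ k * (?C * ((-1) ^ (k + j) * ?N ^ (k - j) * ?F) / ?N ^ k)
          = ?C * ((-1) ^ k * (-1) ^ (k + j)) * (?N ^ (k - j) / ?N ^ k) * ?F"
        by (simp only: times_divide_eq_right times_divide_eq_left mult_ac)
      then show "(-1) ^ k * (?C * ((-1) ^ (k + j) * ?N ^ (k - j) * ?F) / ?N ^ k) =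
          ?C * ((-1) ^ j * (?F / ?N ^ j))"
        unfolding 1 2 by simp
    qed
    then show ?thesis using sum_Pow_card[OF that, of "\<lambda>j. (-1) ^ j * v j"] by simp
  qed
  have "v (card {..<q}) = (\<Sum>T\<in>Pow {..<q}. (-1) ^ card T * ((-1) ^ card T * w (card T)))"
    by (rule inclusion_exclusion_symmetric[of "\<lambda>S. (-1) ^ card S * w (card S)" "\<lambda>S. v (card S)"])
       (simp_all add: w)
  also have "\<dots> = (\<Sum>T\<in>Pow {..<q}. w (card T))"
    by (simp flip: mult.assoc power_mult_distrib)
  also have "\<dots> = (\<Sum>k\<le>q. of_nat (q choose k) * w k)"
    using sum_Pow_card[of "{..<q}" w] by simp
  finally have "?N ^ q * v q = (\<Sum>k\<le>q. of_nat (q choose k) * (?N ^ q * w k))"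
    by (simp add: sum_distrib_left mult.left_commute)
  moreover have "?N ^ q * w k = ?N ^ (q - k) * sidon_defect k n" if "k \<le> q" for k
  proof -
    have "?N ^ q = ?N ^ (q - k) * ?N ^ k" using that by (simp flip: power_add)
    then show ?thesis using N by (simp add: w_def)
  qed
  ultimately show ?thesis using N by (simp add: v_def)
qed

text \<open>
  Entries outside \<open>J\<close> are free.
\<close>

lemma card_box_distinct_sums:
  assumes "finite K" "J \<subseteq> K"
  shows "card {y \<in> K \<rightarrow>\<^sub>E {0..int n}. distinct_sums y J} =
    (n + 1) ^ (card K - card J) * card (ordered_sidon_sets (card J) n)"
proof -
  have fin: "finite J" using assms finite_subset by blast
  have "bij_betw (\<lambda>y. (restrict y J, restrict y (K - J)))
      {y \<in> K \<rightarrow>\<^sub>E {0..int n}. distinct_sums y J} (sidon_maps J n \<times> (K - J \<rightarrow>\<^sub>E {0..int n}))"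
  proof (rule bij_betw_byWitness[where f' = "\<lambda>(u, v). \<lambda>i\<in>K. if i \<in> J then u i else v i"])
    show "\<forall>y\<in>{y \<in> K \<rightarrow>\<^sub>E {0..int n}. distinct_sums y J}.
        (case (restrict y J, restrict y (K - J)) of (u, v) \<Rightarrow> \<lambda>i\<in>K. if i \<in> J then u i else v i) = y"
      by (auto simp: PiE_def extensional_def fun_eq_iff)
    show "\<forall>z\<in>sidon_maps J n \<times> (K - J \<rightarrow>\<^sub>E {0..int n}).
        (restrict (case z of (u, v) \<Rightarrow> \<lambda>i\<in>K. if i \<in> J then u i else v i) J,
         restrict (case z of (u, v) \<Rightarrow> \<lambda>i\<in>K. if i \<in> J then u i else v i) (K - J)) = z"
      using assms(2) by (auto simp: sidon_maps_def PiE_def extensional_def fun_eq_iff)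
    have "distinct_sums (restrict y J) J \<longleftrightarrow> distinct_sums y J" for y :: "'a \<Rightarrow> int"
      by (rule distinct_sums_cong) simp
    then show "(\<lambda>y. (restrict y J, restrict y (K - J))) ` {y \<in> K \<rightarrow>\<^sub>E {0..int n}. distinct_sums y J}
        \<subseteq> sidon_maps J n \<times> (K - J \<rightarrow>\<^sub>E {0..int n})"
      using assms(2) by (auto simp: sidon_maps_def PiE_iff subset_iff)
    have "distinct_sums (\<lambda>i\<in>K. if i \<in> J then u i else v i) J \<longleftrightarrow> distinct_sums u J"
      for u v :: "'a \<Rightarrow> int"
      using assms(2) by (intro distinct_sums_cong) auto
    then show "(\<lambda>(u, v). \<lambda>i\<in>K. if i \<in> J then u i else v i) ` (sidon_maps J n \<times> (K - J \<rightarrow>\<^sub>E {0..int n}))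
        \<subseteq> {y \<in> K \<rightarrow>\<^sub>E {0..int n}. distinct_sums y J}"
      using assms(2) by (auto simp: sidon_maps_def PiE_iff subset_iff)
  qed
  then show ?thesis
    using assms fin
    by (simp add: bij_betw_same_card card_cartesian_product card_sidon_maps card_PiE
        card_Diff_subset nat_add_distrib mult.commute)
qed

lemma sidon_defect_eq_sum:
  assumes "finite K"
  shows "sidon_defect (card K) n = (\<Sum>y \<in> K \<rightarrow>\<^sub>E {0..int n}. \<Sum>J\<in>Pow K.
    (-1) ^ (card K + card J) * of_bool (distinct_sums y J))"
proof -
  have box: "finite (K \<rightarrow>\<^sub>E {0..int n})" using assms by (intro finite_PiE) auto
  have "sidon_defect (card K) n = (\<Sum>J\<in>Pow K. (-1) ^ (card K + card J) *
      of_nat (n + 1) ^ (card K - card J) * of_nat (card (ordered_sidon_sets (card J) n)))"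
    unfolding sidon_defect_def by (rule sum_Pow_card[OF assms, symmetric])
  also have "\<dots> = (\<Sum>J\<in>Pow K. (-1) ^ (card K + card J) *
      (\<Sum>y \<in> K \<rightarrow>\<^sub>E {0..int n}. of_bool (distinct_sums y J)))"
  proof (rule sum.cong[OF refl])
    fix J assume "J \<in> Pow K"
    then have "(\<Sum>y \<in> K \<rightarrow>\<^sub>E {0..int n}. of_bool (distinct_sums y J) :: rat) =
        of_nat ((n + 1) ^ (card K - card J) * card (ordered_sidon_sets (card J) n))"
      using card_box_distinct_sums[OF assms, of J n] box by (simp add: sum_of_bool_eq Int_def)
    then show "(-1) ^ (card K + card J) * of_nat (n + 1) ^ (card K - card J) *
        of_nat (card (ordered_sidon_sets (card J) n)) = (-1) ^ (card K + card J) *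
        (\<Sum>y \<in> K \<rightarrow>\<^sub>E {0..int n}. of_bool (distinct_sums y J) :: rat)" by simp
  qed
  also have "\<dots> = (\<Sum>y \<in> K \<rightarrow>\<^sub>E {0..int n}. \<Sum>J\<in>Pow K.
      (-1) ^ (card K + card J) * of_bool (distinct_sums y J))"
    unfolding sum_distrib_left by (rule sum.swap)
  finally show ?thesis .
qed

section \<open>Growth of the defect\<close>

text \<open>
  The index \<open>k\<close> occurs effectively in a relation satisfied by \<open>y\<close>: the conditions \<open>c \<noteq> k\<close> and
  \<open>d \<noteq> k\<close> ensure that \<open>y k\<close> does not cancel, so it is determined by the other entries. The case
  \<open>b = k\<close> is allowed, it makes the coefficient \<open>2\<close>.
\<close>

definition entangled :: "('a \<Rightarrow> int) \<Rightarrow> 'a set \<Rightarrow> 'a \<Rightarrow> bool" where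
  "entangled y K k \<longleftrightarrow> (\<exists>b\<in>K. \<exists>c\<in>K. \<exists>d\<in>K. c \<noteq> k \<and> d \<noteq> k \<and> y k + y b = y c + y d)"

text \<open>
  A violation that involves \<open>k\<close> on both sides cancels to \<open>y b = y d\<close>, which either is a violation
  inside \<open>J\<close> or entangles \<open>k\<close>; one that involves \<open>k\<close> on one side only entangles \<open>k\<close>.
\<close>

lemma distinct_sums_insert_iff:
  assumes "k \<in> K" "J \<subseteq> K" "\<not> entangled y K k"
  shows "distinct_sums y (insert k J) \<longleftrightarrow> distinct_sums y J"
proof
  assume J: "distinct_sums y J"
  have ne: "c = k \<or> d = k" if "y k + y b = y c + y d" "{b, c, d} \<subseteq> insert k J" for b c d
    using assms that unfolding entangled_def by blast
  have eq: "b = d" if "y b = y d" "{b, d} \<subseteq> insert k J" for b d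
    using ne[of d d d] ne[of b b b] distinct_sumsD[OF J, of b b d d] that by auto
  have cancel: "(b = c \<and> k = d) \<or> (b = d \<and> k = c)"
    if "y k + y b = y c + y d" "{b, c, d} \<subseteq> insert k J" for b c d
    using ne[OF that] eq[of b c] eq[of b d] that by auto
  show "distinct_sums y (insert k J)"
    unfolding distinct_sums_def
  proof (intro ballI impI)
    fix a b c d
    assume abcd: "a \<in> insert k J" "b \<in> insert k J" "c \<in> insert k J" "d \<in> insert k J"
      and s: "y a + y b = y c + y d"
    consider "a = k" | "b = k" | "c = k" | "d = k" | "{a, b, c, d} \<subseteq> J" using abcd by blast
    then show "(a = c \<and> b = d) \<or> (a = d \<and> b = c)"
    proof cases
      case 1 then show ?thesis using cancel[of b c d] s abcd by auto
    next
      case 2 then show ?thesis using cancel[of a c d] s abcd by auto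
    next
      case 3 then show ?thesis using cancel[of d a b] s abcd by auto
    next
      case 4 then show ?thesis using cancel[of c a b] s abcd by auto
    next
      case 5 then show ?thesis using distinct_sumsD[OF J _ _ _ _ s] by blast
    qed
  qed
qed (auto simp: distinct_sums_def)

text \<open>
  The sets \<open>J\<close> with and without \<open>k\<close> cancel in pairs.
\<close>

lemma alternating_sum_not_entangled:
  assumes "finite K" "k \<in> K" "\<not> entangled y K k"
  shows "(\<Sum>J\<in>Pow K. (-1) ^ (card K + card J) * of_bool (distinct_sums y J) :: rat) = 0"
proof -
  define L where "L = K - {k}"
  have L: "K = insert k L" "k \<notin> L" "finite L" using assms by (auto simp: L_def)
  have "(-1) ^ (m + card J) * of_bool (distinct_sums y J) +
      (-1) ^ (m + card (insert k J)) * of_bool (distinct_sums y (insert k J)) = (0 :: rat)"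
    if "J \<in> Pow L" for J m
  proof -
    have "finite J" "k \<notin> J" "J \<subseteq> K" using that L finite_subset by auto
    then show ?thesis using distinct_sums_insert_iff[OF assms(2) _ assms(3), of J] by simp
  qed
  then show ?thesis unfolding L(1) sum_Pow_insert[OF L(3,2)] by (intro sum.neutral) blast
qed

text \<open>
  \<open>e\<close> prescribes for each index one relation by which it is entangled.
\<close>

definition solves :: "('a \<Rightarrow> 'a \<times> 'a \<times> 'a) \<Rightarrow> 'a set \<Rightarrow> ('a \<Rightarrow> int) \<Rightarrow> bool" where
  "solves e K y \<longleftrightarrow> (\<forall>k\<in>K. case e k of (b, c, d) \<Rightarrow> c \<noteq> k \<and> d \<noteq> k \<and> y k + y b = y c + y d)"

text \<open>
  Greedy choice: take an index \<open>v\<close> that no relation chosen so far involves, choose its relation, and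
  continue with the indices outside that relation. Each step uses up at most four indices. The
  relation of \<open>v\<close> involves none of the indices chosen later, so the entries can be recovered in
  the order of choice.
\<close>

lemma eliminable_indices:
  assumes "finite W" "W \<subseteq> K"
  shows "\<exists>V\<subseteq>W. card W \<le> 4 * card V \<and>
    (\<forall>y z. solves e K y \<longrightarrow> solves e K z \<longrightarrow> (\<forall>i. i \<notin> V \<longrightarrow> y i = z i) \<longrightarrow> y = z)"
  using assms
proof (induction "card W" arbitrary: W rule: less_induct)
  case less
  show ?case
  proof (cases "W = {}")
    case True
    then show ?thesis by (intro exI[of _ "{}"]) auto
  next
    case False
    then obtain v where v: "v \<in> W" by blast
    obtain b c d where e: "e v = (b, c, d)" by (cases "e v") auto
    define W' where "W' = W - {v, b, c, d}"
    have fin: "finite W'" "W' \<subseteq> K" using less(2,3) by (auto simp: W'_def)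
    have "card W' < card W"
      using less(2) v by (intro psubset_card_mono) (auto simp: W'_def)
    from less(1)[OF this fin] obtain V where V: "V \<subseteq> W'" "card W' \<le> 4 * card V"
      and det: "\<forall>y z. solves e K y \<longrightarrow> solves e K z \<longrightarrow> (\<forall>i. i \<notin> V \<longrightarrow> y i = z i) \<longrightarrow> y = z"
      by (elim exE conjE)
    have "card W \<le> card (W' \<union> {v, b, c, d})"
      using fin(1) by (intro card_mono) (auto simp: W'_def)
    also have "\<dots> \<le> card W' + card {v, b, c, d}" by (rule card_Un_le)
    also have "card {v, b, c, d} \<le> 4" using card_length[of "[v, b, c, d]"] by simp
    finally have "card W \<le> 4 * card V + 4" using V(2) by simp
    moreover have "card (insert v V) = Suc (card V)"
      using V(1) finite_subset[OF V(1) fin(1)] by (intro card_insert_disjoint) (auto simp: W'_def)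
    ultimately have "card W \<le> 4 * card (insert v V)" by simp
    moreover have "y = z"
      if y: "solves e K y" and z: "solves e K z" and yz: "\<forall>i. i \<notin> insert v V \<longrightarrow> y i = z i" for y z
    proof -
      have "v \<in> K" using v less(3) by blast
      then have rel: "c \<noteq> v" "d \<noteq> v" "y v + y b = y c + y d" "z v + z b = z c + z d"
        using y z e unfolding solves_def by auto
      have "y i = z i" if "i \<in> {b, c, d}" "i \<noteq> v" for i
      proof -
        have "i \<notin> insert v V" using V(1) that by (auto simp: W'_def)
        then show ?thesis using yz by blast
      qed
      then have "y c = z c" "y d = z d" "b \<noteq> v \<Longrightarrow> y b = z b" using rel(1,2) by simp_all
      then have "y v = z v" using rel(3,4) by (cases "b = v") auto
      then have "\<forall>i. i \<notin> V \<longrightarrow> y i = z i" using yz by auto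
      then show ?thesis using det y z by simp
    qed
    moreover have "insert v V \<subseteq> W" using V(1) v by (auto simp: W'_def)
    ultimately show ?thesis by (intro exI[of _ "insert v V"]) simp
  qed
qed

text \<open>
  The exponent is \<open>card K\<close> minus the least integer that is at least \<open>card K / 4\<close>.
\<close>

lemma card_all_entangled_le:
  assumes "finite K"
  shows "card {y \<in> K \<rightarrow>\<^sub>E {0..int n}. \<forall>k\<in>K. entangled y K k} \<le>
    card (K \<rightarrow>\<^sub>E K \<times> K \<times> K) * (n + 1) ^ (3 * card K div 4)"
proof -
  define Z where "Z e = {y \<in> K \<rightarrow>\<^sub>E {0..int n}. solves e K y}" for e
  have box: "finite (K \<rightarrow>\<^sub>E {0..int n})" using assms by (intro finite_PiE) auto
  have E: "finite (K \<rightarrow>\<^sub>E K \<times> K \<times> K)" using assms by (intro finite_PiE) auto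
  have cover: "{y \<in> K \<rightarrow>\<^sub>E {0..int n}. \<forall>k\<in>K. entangled y K k} \<subseteq> (\<Union>e \<in> K \<rightarrow>\<^sub>E K \<times> K \<times> K. Z e)"
  proof
    fix y assume y: "y \<in> {y \<in> K \<rightarrow>\<^sub>E {0..int n}. \<forall>k\<in>K. entangled y K k}"
    define Q where "Q k t \<longleftrightarrow> t \<in> K \<times> K \<times> K \<and> (case t of (b, c, d) \<Rightarrow>
        c \<noteq> k \<and> d \<noteq> k \<and> y k + y b = y c + y d)" for k t
    have ex: "\<exists>t. Q k t" if "k \<in> K" for k
    proof -
      have "entangled y K k" using y that by simp
      then obtain b c d where "b \<in> K" "c \<in> K" "d \<in> K" "c \<noteq> k" "d \<noteq> k" "y k + y b = y c + y d"
        unfolding entangled_def by (elim bexE conjE)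
      then show ?thesis unfolding Q_def by (intro exI[of _ "(b, c, d)"]) simp
    qed
    define e where "e k = (SOME t. Q k t)" for k
    have Q: "Q k (e k)" if "k \<in> K" for k
      unfolding e_def by (rule someI_ex[OF ex[OF that]])
    have e: "e k \<in> K \<times> K \<times> K" if "k \<in> K" for k
      using Q[OF that] unfolding Q_def by (rule conjunct1)
    have sol: "solves e K y"
      unfolding solves_def using Q unfolding Q_def by simp
    have mem: "restrict e K \<in> K \<rightarrow>\<^sub>E K \<times> K \<times> K"
      by (intro restrict_PiE_iff[THEN iffD2] ballI e)
    have "solves (restrict e K) K y"
      using sol unfolding solves_def by simp
    then have "y \<in> Z (restrict e K)"
      using y unfolding Z_def by simp
    then show "y \<in> (\<Union>e \<in> K \<rightarrow>\<^sub>E K \<times> K \<times> K. Z e)" by (rule UN_I[OF mem])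
  qed
  have bound: "card (Z e) \<le> (n + 1) ^ (3 * card K div 4)" for e
  proof -
    obtain V where V: "V \<subseteq> K" "card K \<le> 4 * card V"
      and det: "\<forall>y z. solves e K y \<longrightarrow> solves e K z \<longrightarrow> (\<forall>i. i \<notin> V \<longrightarrow> y i = z i) \<longrightarrow> y = z"
      using eliminable_indices[OF assms order_refl, of e] by (elim exE conjE)
    have "inj_on (\<lambda>y. restrict y (K - V)) (Z e)"
    proof (rule inj_onI)
      fix y z assume yz: "y \<in> Z e" "z \<in> Z e" and eq: "restrict y (K - V) = restrict z (K - V)"
      have "\<forall>i. i \<notin> V \<longrightarrow> y i = z i"
      proof (intro allI impI)
        fix i assume "i \<notin> V"
        show "y i = z i"
        proof (cases "i \<in> K")
          case True
          then show ?thesis using fun_cong[OF eq, of i] \<open>i \<notin> V\<close> by simp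
        next
          case False
          then show ?thesis using yz by (auto simp: Z_def PiE_def extensional_def)
        qed
      qed
      then show "y = z" using det yz by (simp add: Z_def)
    qed
    moreover have "(\<lambda>y. restrict y (K - V)) ` Z e \<subseteq> K - V \<rightarrow>\<^sub>E {0..int n}"
      by (auto simp: Z_def)
    ultimately have "card (Z e) \<le> card (K - V \<rightarrow>\<^sub>E {0..int n})"
      using assms by (intro card_inj_on_le) (auto intro: finite_PiE)
    also have "\<dots> = (n + 1) ^ (card K - card V)"
      using assms finite_subset[OF V(1) assms] V(1)
      by (simp add: card_PiE card_Diff_subset nat_add_distrib)
    also have "\<dots> \<le> (n + 1) ^ (3 * card K div 4)"
      using V(2) by (intro power_increasing) linarith+
    finally show ?thesis .
  qed
  have "card {y \<in> K \<rightarrow>\<^sub>E {0..int n}. \<forall>k\<in>K. entangled y K k} \<le> card (\<Union>e \<in> K \<rightarrow>\<^sub>E K \<times> K \<times> K. Z e)"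
    using cover E finite_subset[OF _ box, of "Z e" for e]
    by (intro card_mono finite_UN_I) (auto simp: Z_def)
  also have "\<dots> \<le> (\<Sum>e \<in> K \<rightarrow>\<^sub>E K \<times> K \<times> K. card (Z e))" by (rule card_UN_le[OF E])
  also have "\<dots> \<le> (\<Sum>e \<in> K \<rightarrow>\<^sub>E K \<times> K \<times> K. (n + 1) ^ (3 * card K div 4))"
    by (intro sum_mono bound)
  finally show ?thesis by simp
qed

text \<open>
  Only the points all of whose indices are entangled contribute, each at most the number
  \<open>2 ^ k\<close> of subsets.
\<close>

lemma sidon_defect_growth:
  "\<exists>C. \<forall>n. \<bar>sidon_defect k n\<bar> \<le> C * of_nat (n + 1) ^ (3 * k div 4)"
proof -
  define K where "K = {..<k}"
  have K: "finite K" "card K = k" by (auto simp: K_def)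
  define a :: "(nat \<Rightarrow> int) \<Rightarrow> rat" where
    "a y = (\<Sum>J\<in>Pow K. (-1) ^ (card K + card J) * of_bool (distinct_sums y J))" for y
  have a: "\<bar>a y\<bar> \<le> 2 ^ k" for y
  proof -
    have "\<bar>a y\<bar> \<le> (\<Sum>J\<in>Pow K. 1)"
      unfolding a_def by (rule order_trans[OF sum_abs sum_mono]) (simp add: abs_mult power_abs)
    then show ?thesis using K by (simp add: card_Pow)
  qed
  have "\<bar>sidon_defect k n\<bar> \<le>
    (2 ^ k * of_nat (card (K \<rightarrow>\<^sub>E K \<times> K \<times> K))) * of_nat (n + 1) ^ (3 * k div 4)" for n
  proof -
    let ?B = "K \<rightarrow>\<^sub>E {0..int n}" and ?E = "{y \<in> K \<rightarrow>\<^sub>E {0..int n}. \<forall>k\<in>K. entangled y K k}"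
    have "finite ?B" using K by (intro finite_PiE) auto
    moreover have "a y = 0" if "y \<in> ?B - ?E" for y
      using that alternating_sum_not_entangled[OF K(1), of _ y] unfolding a_def by blast
    ultimately have "(\<Sum>y\<in>?B. a y) = (\<Sum>y\<in>?E. a y)"
      by (intro sum.mono_neutral_right) auto
    then have "sidon_defect k n = (\<Sum>y\<in>?E. a y)"
      using sidon_defect_eq_sum[OF K(1), of n] K(2) by (simp add: a_def)
    then have "\<bar>sidon_defect k n\<bar> \<le> (\<Sum>y\<in>?E. \<bar>a y\<bar>)" by (simp only: sum_abs)
    also have "\<dots> \<le> of_nat (card ?E) * 2 ^ k" by (rule sum_bounded_above) (rule a)
    also have "\<dots> \<le> of_nat (card (K \<rightarrow>\<^sub>E K \<times> K \<times> K) * (n + 1) ^ (3 * k div 4)) * 2 ^ k"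
      using card_all_entangled_le[OF K(1), of n] K(2) by (intro mult_right_mono of_nat_mono) auto
    finally show ?thesis by (simp add: mult_ac)
  qed
  then show ?thesis by blast
qed

text \<open>
  Along each residue class the growth bound applies to a single polynomial and bounds its degree.
\<close>

lemma sidon_defect_expansion:
  "\<exists>m>0. \<exists>P :: nat \<Rightarrow> rat poly. (\<forall>r. degree (P r) \<le> 3 * k div 4) \<and>
     (\<forall>n. sidon_defect k n = poly (P (n mod m)) (of_nat n))"
proof -
  obtain g where g: "\<And>j. int_quasi_poly (g j)"
    "\<And>j n. of_nat (card (ordered_sidon_sets j n)) = g j (int n)"
    using card_ordered_sidon_sets_quasi_poly by metis
  have "int_quasi_poly (\<lambda>u. \<Sum>j\<le>k. of_nat (k choose j) * ((-1) ^ (k + j) *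
      (of_int u + 1) ^ (k - j) * g j u))"
    by (intro int_quasi_poly_sum int_quasi_poly_mult int_quasi_poly_const int_quasi_poly_power
        int_quasi_poly_add int_quasi_poly_of_int g)
  then obtain m P where m: "m > 0" and P: "\<And>u. (\<Sum>j\<le>k. of_nat (k choose j) * ((-1) ^ (k + j) *
      (of_int u + 1) ^ (k - j) * g j u)) = poly (P (u mod m)) (of_int u)"
    unfolding int_quasi_poly_def by blast
  have defect: "sidon_defect k n = poly (P (int n mod m)) (of_nat n)" for n
    using P[of "int n"] by (simp add: sidon_defect_def g(2) add.commute)
  define M where "M = nat m"
  have M: "M > 0" "m = int M" using m by (auto simp: M_def)
  define Q where "Q r = (if r < M then P (int r) else 0)" for r
  have Q: "sidon_defect k n = poly (Q (n mod M)) (of_nat n)" for n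
    using defect[of n] M by (simp add: Q_def zmod_int)
  obtain C where C: "\<And>n. \<bar>sidon_defect k n\<bar> \<le> C * of_nat (n + 1) ^ (3 * k div 4)"
    using sidon_defect_growth by blast
  have "degree (Q r) \<le> 3 * k div 4" for r
  proof (cases "r < M")
    case True
    show ?thesis
    proof (rule poly_degree_le_of_growth)
      fix N
      have "(N * M + r) mod M = r" using True by simp
      then have "\<bar>poly (Q r) (of_nat (N * M + r))\<bar> \<le> C * of_nat (N * M + r + 1) ^ (3 * k div 4)"
        using C[of "N * M + r"] Q[of "N * M + r"] by metis
      moreover have "N * M + r \<ge> N" using M(1) by (simp add: trans_le_add1)
      ultimately show "\<exists>n\<ge>N. \<bar>poly (Q r) (of_nat n)\<bar> \<le> C * of_nat (n + 1) ^ (3 * k div 4)"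
        by blast
    qed
  qed (simp add: Q_def)
  then show ?thesis using M(1) Q by blast
qed

section \<open>Uniform expansion in the size\<close>

definition binomial_poly :: "nat \<Rightarrow> rat poly" where
  "binomial_poly j = smult (1 / fact j) (\<Prod>i<j. [:- of_nat i, 1:])"

lemma poly_binomial_poly: "poly (binomial_poly j) x = x gchoose j"
  by (simp add: binomial_poly_def gbinomial_prod_rev poly_prod atLeast0LessThan)

text \<open>
  The contribution of \<open>n ^ a\<close> in the \<open>k\<close>-th defect to the coefficient of \<open>n ^ (q - r)\<close>: the power
  of \<open>n\<close> drops by \<open>k - a\<close> from the defect and by \<open>i = r - (k - a)\<close> from the binomial.
\<close>

lemma power_mult_binomial_expansion:
  fixes x :: rat
  assumes "a \<le> k" "k \<le> q"
  shows "x ^ a * (x + 1) ^ (q - k) =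
    (\<Sum>r\<le>q. if k \<le> r + a then of_nat ((q - k) choose (r + a - k)) * x ^ (q - r) else 0)"
proof -
  have "x ^ a * (x + 1) ^ (q - k) = (\<Sum>i\<le>q - k. of_nat ((q - k) choose i) * x ^ (a + (q - k - i)))"
    using binomial_ring[of 1 x "q - k"] by (simp add: add.commute sum_distrib_left power_add mult_ac)
  also have "\<dots> = (\<Sum>r\<in>(\<lambda>i. i + (k - a)) ` {..q - k}. of_nat ((q - k) choose (r + a - k)) * x ^ (q - r))"
    using assms by (subst sum.reindex) (auto intro!: inj_onI sum.cong simp: algebra_simps)
  also have "\<dots> = (\<Sum>r\<le>q. if k \<le> r + a then of_nat ((q - k) choose (r + a - k)) * x ^ (q - r) else 0)"
  proof (rule sum.mono_neutral_cong_left)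
    show "(\<lambda>i. i + (k - a)) ` {..q - k} \<subseteq> {..q}" using assms by auto
    show "\<forall>r\<in>{..q} - (\<lambda>i. i + (k - a)) ` {..q - k}.
        (if k \<le> r + a then of_nat ((q - k) choose (r + a - k)) * x ^ (q - r) else 0) = 0"
    proof
      fix r assume r: "r \<in> {..q} - (\<lambda>i. i + (k - a)) ` {..q - k}"
      have "q - k < r + a - k" if "k \<le> r + a"
      proof (rule ccontr)
        assume "\<not> q - k < r + a - k"
        moreover have "r = (r + a - k) + (k - a)" using that assms by simp
        ultimately show False using r by (metis DiffD2 atMost_iff imageI not_le)
      qed
      then show "(if k \<le> r + a then of_nat ((q - k) choose (r + a - k)) * x ^ (q - r) else 0) = 0"
        by simp
    qed
  qed (use assms in auto)
  finally show ?thesis .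
qed

theorem theorem40:
  fixes f :: "nat \<Rightarrow> nat \<Rightarrow> rat"
  assumes "\<And>q n. f q n = of_nat (card (ordered_sidon_sets q n))"
  shows "\<exists>e p. infinite_depth [:0, 1:] e \<and> two_level_quasi_polynomial [:0, 1:] e p f"
proof -
  have "\<forall>k. \<exists>m. \<exists>P :: nat \<Rightarrow> rat poly. m > 0 \<and> (\<forall>r. degree (P r) \<le> 3 * k div 4) \<and>
     (\<forall>n. sidon_defect k n = poly (P (n mod m)) (of_nat n))"
    using sidon_defect_expansion by blast
  then obtain m and P :: "nat \<Rightarrow> nat \<Rightarrow> rat poly" where m: "\<And>k. m k > 0"
    and deg: "\<And>k r. degree (P k r) \<le> 3 * k div 4"
    and P: "\<And>k n. sidon_defect k n = poly (P k (n mod m k)) (of_nat n)"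
    by metis
  define p where "p r = (\<Prod>k\<le>4 * r. m k)" for r
  have p_pos: "p r > 0" for r using m by (simp add: p_def)
  have p_Suc: "p r dvd p (Suc r)" for r
    unfolding p_def by (rule prod_dvd_prod_subset) auto
  have mod_p: "n mod p r mod m k = n mod m k" if "k \<le> 4 * r" for n r k
    using that by (intro mod_mod_cancel) (auto simp: p_def intro: dvd_prodI)
  \<comment> \<open>contribution of the \<open>k\<close>-th defect to the coefficient of \<open>n ^ (q - r)\<close>\<close>
  define C where "C q n r k = of_nat (q choose k) * (\<Sum>a\<le>k. if k \<le> r + a then
      coeff (P k (n mod m k)) a * of_nat ((q - k) choose (r + a - k)) else 0)" for q n r k
  define c where "c q r n = (\<Sum>k\<le>4 * r. C q n r k)" for q r n
  define \<phi> where "\<phi> r s = (\<Sum>k\<le>4 * r. binomial_poly k * (\<Sum>a\<le>k. if k \<le> r + a then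
      smult (coeff (P k (s mod m k)) a) (pcompose (binomial_poly (r + a - k)) [:- of_nat k, 1:])
      else 0))" for r s
  have C_large: "C q n r k = 0" if "4 * r < k" for q n r k
  proof -
    have "coeff (P k (n mod m k)) a = 0" if "k \<le> r + a" for a
    proof -
      \<comment> \<open>\<open>a \<ge> k - r\<close> and \<open>k > 4 * r\<close> put \<open>a\<close> above the degree of the defect\<close>
      have "3 * k div 4 < a" using that \<open>4 * r < k\<close> by linarith
      then show ?thesis using deg[of k] by (intro coeff_eq_0) (rule le_less_trans)
    qed
    then show ?thesis unfolding C_def by (auto intro!: sum.neutral)
  qed
  have C_choose: "C q n r k = 0" if "q < k" for q n r k
    using that by (simp add: C_def)
  have C_degree: "C q n r k = 0" if "q < r" for q n r k
  proof (cases "q < k")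
    case False
    then have "q - k < r + a - k" if "k \<le> r + a" for a using that \<open>q < r\<close> by linarith
    then show ?thesis unfolding C_def by (auto intro!: sum.neutral)
  qed (rule C_choose)
  have c_poly: "c q r n = poly (\<phi> r (n mod p r)) (of_nat q)" for q r n
    unfolding c_def \<phi>_def poly_sum
  proof (rule sum.cong[OF refl])
    fix k assume k: "k \<in> {..4 * r}"
    show "C q n r k = poly (binomial_poly k * (\<Sum>a\<le>k. if k \<le> r + a then
      smult (coeff (P k (n mod p r mod m k)) a) (pcompose (binomial_poly (r + a - k)) [:- of_nat k, 1:])
      else 0)) (of_nat q)"
    \<comment> \<open>natural subtraction in \<open>q - k\<close> is harmless: the factor \<open>q choose k\<close> vanishes when it truncates\<close>
    proof (cases "q < k")
      case True
      then show ?thesis by (simp add: C_choose poly_binomial_poly flip: binomial_gbinomial)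
    next
      case False
      then have q: "of_nat q + - of_nat k = (of_nat (q - k) :: rat)" by (simp add: of_nat_diff)
      show ?thesis
        using k by (simp add: C_def mod_p poly_sum poly_binomial_poly poly_pcompose if_distrib[of "\<lambda>p. poly p _"]
            q[simplified] binomial_gbinomial add.commute cong: if_cong)
    qed
  qed
  \<comment> \<open>\<open>p r\<close> is independent of \<open>q\<close>, as the sum defining \<open>c q r\<close> ends at \<open>4 * r\<close>\<close>
  have c_periodic: "periodic (c q r)" for q r
    unfolding periodic_def using p_pos[of r] by (intro exI[of _ "p r"]) (simp add: c_poly)
  have expansion: "f q n = (\<Sum>r\<le>q. c q r n * of_nat n ^ (q - r))" for q n
  proof -
    let ?n = "of_nat n :: rat"
    have summand: "of_nat (n + 1) ^ (q - k) * sidon_defect k n =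
        (\<Sum>r\<le>q. (\<Sum>a\<le>k. if k \<le> r + a then
          coeff (P k (n mod m k)) a * of_nat ((q - k) choose (r + a - k)) else 0) * ?n ^ (q - r))"
      if "k \<le> q" for k
    proof -
      let ?P = "P k (n mod m k)"
      have "degree ?P \<le> k" using deg[of k "n mod m k"] by linarith
      then have "sidon_defect k n = (\<Sum>a\<le>k. coeff ?P a * ?n ^ a)"
        unfolding P poly_altdef by (intro sum.mono_neutral_left) (auto simp: coeff_eq_0)
      then have "of_nat (n + 1) ^ (q - k) * sidon_defect k n =
          (\<Sum>a\<le>k. coeff ?P a * (?n ^ a * (?n + 1) ^ (q - k)))"
        by (simp add: sum_distrib_left mult_ac add.commute)
      also have "\<dots> = (\<Sum>a\<le>k. \<Sum>r\<le>q. (if k \<le> r + a then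
          coeff ?P a * of_nat ((q - k) choose (r + a - k)) else 0) * ?n ^ (q - r))"
        using that by (intro sum.cong refl)
          (auto simp: power_mult_binomial_expansion sum_distrib_left mult.assoc intro!: sum.cong)
      also have "\<dots> = (\<Sum>r\<le>q. (\<Sum>a\<le>k. if k \<le> r + a then
          coeff ?P a * of_nat ((q - k) choose (r + a - k)) else 0) * ?n ^ (q - r))"
        by (subst sum.swap) (simp add: sum_distrib_right)
      finally show ?thesis .
    qed
    have c_eq: "(\<Sum>k\<le>q. C q n r k) = c q r n" for r
      unfolding c_def by (rule sum.mono_neutral_cong) (auto simp: C_large C_choose)
    have "f q n = (\<Sum>k\<le>q. of_nat (q choose k) * (of_nat (n + 1) ^ (q - k) * sidon_defect k n))"
      unfolding assms by (rule card_ordered_sidon_sets_eq_sum_defect)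
    also have "\<dots> = (\<Sum>k\<le>q. \<Sum>r\<le>q. C q n r k * ?n ^ (q - r))"
      by (intro sum.cong refl)
        (simp only: atMost_iff summand C_def, subst sum_distrib_left, simp only: mult.assoc)
    also have "\<dots> = (\<Sum>r\<le>q. (\<Sum>k\<le>q. C q n r k) * ?n ^ (q - r))"
      by (subst sum.swap) (simp add: sum_distrib_right)
    finally show ?thesis by (simp only: c_eq)
  qed
  have leading: "c q 0 n = 1" for q n
  proof -
    have "sidon_defect 0 n = 1"
    proof -
      have "ordered_sidon_sets 0 n = {[]}"
        by (auto simp: ordered_sidon_sets_def sidon_set_def)
      then show ?thesis by (simp add: sidon_defect_def)
    qed
    moreover have "degree (P 0 (n mod m 0)) = 0" using deg[of 0 "n mod m 0"] by simp
    ultimately have "coeff (P 0 (n mod m 0)) 0 = 1"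
      using P[of 0 n] by (simp add: poly_altdef)
    then show ?thesis by (simp add: c_def C_def)
  qed
  have S: "nonneg_set [:0, 1:] = UNIV" by (simp add: nonneg_set_def)
  have D: "deg_at [:0, 1:] q = q" for q by (simp add: deg_at_def)
  have "two_level_quasi_polynomial [:0, 1:] (\<lambda>_. \<infinity>) p f"
    unfolding two_level_quasi_polynomial_def S D
  proof (intro conjI)
    show "numerical_polynomial [:0, 1:]" by (simp add: numerical_polynomial_def)
    show "\<forall>r. p r > 0 \<and> p r dvd p (Suc r)" using p_pos p_Suc by simp
    show "\<forall>q\<in>UNIV. quasi_polynomial q (f q)"
      unfolding quasi_polynomial_def
      using c_periodic expansion leading by (metis zero_neq_one)
    show "\<exists>c \<phi>. \<forall>q\<in>UNIV. (\<forall>r. periodic (c q r)) \<and> (\<forall>r>q. \<forall>n. c q r n = 0) \<and>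
      (\<forall>n. f q n = (\<Sum>r\<le>q. c q r n * of_nat n ^ (q - r))) \<and>
      (\<forall>r n. Fin (int r) \<le> \<infinity> \<longrightarrow> c q r n = poly (\<phi> r (n mod p r)) (rat_of_nat q))"
      using c_periodic expansion c_poly C_degree
      by (intro exI[of _ c] exI[of _ \<phi>]) (simp add: c_def)
  qed simp_all
  moreover have "infinite_depth [:0, 1:] (\<lambda>_. \<infinity>)" by (simp add: infinite_depth_def)
  ultimately show ?thesis by blast
qed

end
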